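(* Let $d\ge 2$ and consider the plaquette percolation model on $\Pi_d$ with parameter $p\in[0,1]$ and probability measure $\mathbb{P}_p$. If $p<\mu_d^{-2}$, then almost surely there exists a finite set $S\subseteq\Pi_d$ of unoccupied plaquettes whose union $[S]$ is a sphere with $0$ in its inside. Moreover, the (random) set $S$ may be chosen so that, for any $\alpha\in(\mu_d p,1)$, there exists $C=C(p,d,\alpha)<\infty$ such that $$\mathbb{P}_p\big(\operatorname{rad}[S]\ge r\big)\le C\alpha^r,\qquad r>0.$$
   Context: Elements of $\mathbb{Z}^d$ are called sites. For a site $z$, let $Q(z):=[-\tfrac12,\tfrac12]^d+z$ be the closed unit $d$-cube centred at $z$. A plaquette is any closed unit $(d-1)$-cube in $\mathbb{R}^d$ that is a face of some $Q(z)$, $z\in\mathbb{Z}^d$; $\Pi_d$ is the set of all plaquettes. For $S\subseteq\Pi_d$, write $[S]:=\bigcup_{\pi\in S}\pi\subseteq\mathbb{R}^d$. Plaquette percolation with parameter $p$: each plaquette of $\Pi_d$ is declared occupied with probability $p$ and otherwise unoccupied, independently for different plaquettes; the probability measure is $\mathbb{P}_p$. A sphere of $\mathbb{R}^d$ is a simplicial complex, embedded in $\mathbb{R}^d$, that is homeomorphic to the unit sphere $\{x\in\mathbb{R}^d:\|x\|_2=1\}$. The complement in $\mathbb{R}^d$ of a sphere has one bounded and one unbounded path-component, called respectively its inside and its outside. The radius of $A\subseteq\mathbb{R}^d$ is $\operatorname{rad}A:=\sup\{\|x\|_1:x\in A\}$. The connective constant of $\mathbb{Z}^d$ is $\mu_d:=\lim_{k\to\infty}\sigma(k)^{1/k}$,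 where $\sigma(k)$ is the number of nearest-neighbour (with respect to $\ell^1$ distance) self-avoiding paths of length $k$ in $\mathbb{Z}^d$ starting at the origin. *)

theory Defs
  imports "HOL-Probability.Probability"
begin

definition sites :: "(real ^ 'd) set" where
  "sites = {z. \<forall>i. z $ i \<in> \<int>}"

definition unit_cube :: "real ^ 'd \<Rightarrow> (real ^ 'd) set" where
  "unit_cube z = cbox (z - vec (1/2)) (z + vec (1/2))"

text \<open>The \<open>(d-1)\<close>-dimensional faces of a cube are its facets.\<close>

definition plaquettes :: "(real ^ 'd) set set" where
  "plaquettes = {\<pi>. \<exists>z \<in> sites. \<pi> facet_of unit_cube z}"

text \<open>A configuration \<open>\<omega>\<close> maps a plaquette \<open>\<pi>\<close> to True iff \<open>\<pi>\<close> is occupied.\<close>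

definition plaquette_percolation :: "real \<Rightarrow> ((real ^ 'd) set \<Rightarrow> bool) measure" where
  "plaquette_percolation p = PiM plaquettes (\<lambda>_. measure_pmf (bernoulli_pmf p))"

definition is_sphere :: "(real ^ 'd) set \<Rightarrow> bool" where
  "is_sphere A \<longleftrightarrow>
     (\<exists>\<C>. simplicial_complex \<C> \<and> A = \<Union>\<C>) \<and> A homeomorphic sphere (0 :: real ^ 'd) 1"

text \<open>The inside of a sphere is rendered by the library constant \<^const>\<open>inside\<close>, which speaks
  about connected components of the complement.  For closed sets, in particular for spheres,
  these are the path-components.\<close>

lemma inside_eq_bounded_path_components:
  fixes A :: "(real ^ 'd) set"
  assumes "closed A"
  shows "inside A = {x. x \<notin> A \<and> bounded (path_component_set (- A) x)}"
  using assms unfolding inside_def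
  by (simp add: open_Compl open_path_connected_component_set)

definition l1_norm :: "real ^ 'd \<Rightarrow> real" where
  "l1_norm x = (\<Sum>i\<in>UNIV. \<bar>x $ i\<bar>)"

text \<open>Extended-real valued, so that unbounded sets have infinite radius.\<close>

definition rad :: "(real ^ 'd) set \<Rightarrow> ereal" where
  "rad A = (SUP x\<in>A. ereal (l1_norm x))"

text \<open>A path of length \<open>k\<close> has \<open>k\<close> steps and hence \<open>k + 1\<close> sites.\<close>

definition self_avoiding_paths :: "nat \<Rightarrow> (real ^ 'd) list set" where
  "self_avoiding_paths k =
     {w. length w = k + 1 \<and> hd w = 0 \<and> set w \<subseteq> sites \<and> distinct w \<and>
         (\<forall>i<k. l1_norm (w ! Suc i - w ! i) = 1)}"

definition connective_constant :: "'d::finite itself \<Rightarrow> real" where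
  "connective_constant _ =
     lim (\<lambda>k. root k (real (card (self_avoiding_paths k :: (real ^ 'd) list set))))"

definition separating_sphere ::
    "((real ^ 'd) set \<Rightarrow> bool) \<Rightarrow> (real ^ 'd) set set \<Rightarrow> bool" where
  "separating_sphere \<omega> S \<longleftrightarrow>
     finite S \<and> S \<subseteq> plaquettes \<and> (\<forall>\<pi>\<in>S. \<not> \<omega> \<pi>) \<and> is_sphere (\<Union>S) \<and> 0 \<in> inside (\<Union>S)"

end

theory Submission
  imports Defs
begin

text \<open>Let \<open>D\<close> be the set of sites reachable from \<open>0\<close> by nearest-neighbour steps that either decrease
  the \<open>\<ell>\<^sup>1\<close>-norm or cross an occupied plaquette.  All plaquettes separating \<open>D\<close> from its
  complement are unoccupied.  As inward steps are free, the union of the unit cubes centred in \<open>D\<close>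
  is a union of boxes around \<open>0\<close>; if \<open>D\<close> is finite, it is therefore compact and strictly
  star-shaped, and radial projection maps its boundary homeomorphically onto the unit sphere.
  A self-avoiding path of length \<open>k\<close> from \<open>0\<close> to distance \<open>n\<close> has \<open>(k + n) / 2\<close> outward steps, whose
  plaquettes are distinct, so \<open>D\<close> reaches distance \<open>n\<close> with probability at most
  \<open>\<Sum>k\<ge>n. \<sigma>(k) p\<^bsup>(k + n) / 2\<^esup>\<close>, which decays roughly like \<open>(\<mu> p)\<^sup>n\<close> when \<open>\<mu>\<^sup>2 p < 1\<close>.\<close>

section \<open>Sites, cubes and plaquettes\<close>

definition adjacent :: "real ^ 'd::finite \<Rightarrow> real ^ 'd \<Rightarrow> bool" where
  "adjacent x y \<longleftrightarrow> x \<in> sites \<and> y \<in> sites \<and> l1_norm (y - x) = 1"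

definition separator :: "real ^ 'd::finite \<Rightarrow> real ^ 'd \<Rightarrow> (real ^ 'd) set" where
  "separator x y = unit_cube x \<inter> unit_cube y"

lemma mem_unit_cube: "v \<in> unit_cube z \<longleftrightarrow> (\<forall>i. \<bar>v $ i - z $ i\<bar> \<le> 1/2)"
  unfolding unit_cube_def mem_box_cart
    vector_minus_component vector_add_component vec_component abs_le_iff
  by (intro iff_allI) linarith

lemma interior_unit_cube: "v \<in> interior (unit_cube z) \<longleftrightarrow> (\<forall>i. \<bar>v $ i - z $ i\<bar> < 1/2)"
  unfolding unit_cube_def interior_cbox mem_box_cart
    vector_minus_component vector_add_component vec_component abs_less_iff
  by (intro iff_allI) linarith

lemma mem_sites: "z \<in> sites \<longleftrightarrow> (\<forall>i. z $ i \<in> \<int>)"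
  by (simp add: sites_def)

lemma zero_in_sites [simp]: "0 \<in> sites"
  by (simp add: mem_sites)

lemma sites_diff: "x \<in> sites \<Longrightarrow> y \<in> sites \<Longrightarrow> x - y \<in> sites"
  by (simp add: mem_sites)

lemma l1_norm_0 [simp]: "l1_norm 0 = 0"
  by (simp add: l1_norm_def)

lemma component_le_l1_norm: "\<bar>x $ i\<bar> \<le> l1_norm x"
  unfolding l1_norm_def by (rule member_le_sum) auto

lemma l1_norm_nonneg: "0 \<le> l1_norm x"
  by (simp add: l1_norm_def sum_nonneg)

text \<open>Norm bookkeeping for a change in one coordinate: all other summands cancel.\<close>

lemma l1_norm_diff_coord:
  assumes "\<And>i. i \<noteq> j \<Longrightarrow> \<bar>x $ i\<bar> = \<bar>y $ i\<bar>"
  shows "l1_norm y - l1_norm x = \<bar>y $ j\<bar> - \<bar>x $ j\<bar>"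
proof -
  have "l1_norm z = \<bar>z $ j\<bar> + (\<Sum>i\<in>UNIV - {j}. \<bar>z $ i\<bar>)" for z :: "real ^ 'a"
    unfolding l1_norm_def by (rule sum.remove) auto
  moreover have "(\<Sum>i\<in>UNIV - {j}. \<bar>x $ i\<bar>) = (\<Sum>i\<in>UNIV - {j}. \<bar>y $ i\<bar>)"
    by (rule sum.cong) (auto simp: assms)
  ultimately show ?thesis by simp
qed

lemma l1_norm_Ints: "x \<in> sites \<Longrightarrow> l1_norm x \<in> \<int>"
  unfolding l1_norm_def by (rule Ints_sum) (auto simp: mem_sites)

lemma l1_norm_Nats: "x \<in> sites \<Longrightarrow> \<exists>n. l1_norm x = real n"
  using l1_norm_Ints[of x] l1_norm_nonneg[of x]
  by (metis Ints_cases nonneg_int_cases of_int_0_le_iff of_int_of_nat_eq)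

lemma Ints_nonzero_abs_ge1: "(a::real) \<in> \<int> \<Longrightarrow> a \<noteq> 0 \<Longrightarrow> \<bar>a\<bar> \<ge> 1"
  by (auto elim!: Ints_cases simp: of_int_abs[symmetric] simp del: of_int_abs)

lemma Ints_abs_lt1_eq: "(a::real) \<in> \<int> \<Longrightarrow> b \<in> \<int> \<Longrightarrow> \<bar>a - b\<bar> < 1 \<Longrightarrow> a = b"
  using Ints_nonzero_abs_ge1[of "a - b"] by force

text \<open>A nonzero integer coordinate of \<open>y - x\<close> already contributes at least 1 to
  the norm, so nothing is left for the others.\<close>

lemma adjacentE:
  assumes "adjacent x y"
  obtains j where "\<bar>y $ j - x $ j\<bar> = 1" "\<And>i. i \<noteq> j \<Longrightarrow> y $ i = x $ i"
proof -
  have s: "y - x \<in> sites" and one: "l1_norm (y - x) = 1"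
    using assms by (auto simp: adjacent_def sites_diff)
  then obtain j where j: "(y - x) $ j \<noteq> 0"
    by (metis l1_norm_0 vec_eq_iff zero_index zero_neq_one)
  have ge: "\<bar>(y - x) $ j\<bar> \<ge> 1"
    using Ints_nonzero_abs_ge1 s j by (auto simp: mem_sites)
  have split: "l1_norm (y - x) = \<bar>(y - x) $ j\<bar> + (\<Sum>i\<in>UNIV - {j}. \<bar>(y - x) $ i\<bar>)"
    unfolding l1_norm_def by (rule sum.remove) auto
  have nn: "(\<Sum>i\<in>UNIV - {j}. \<bar>(y - x) $ i\<bar>) \<ge> 0"
    by (rule sum_nonneg) auto
  have "(\<Sum>i\<in>UNIV - {j}. \<bar>(y - x) $ i\<bar>) = 0" using split nn one ge by linarith
  then have "\<And>i. i \<noteq> j \<Longrightarrow> y $ i = x $ i"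
    by (subst (asm) sum_nonneg_eq_0_iff) auto
  moreover have "\<bar>(y - x) $ j\<bar> = 1" using split nn one ge by linarith
  then have "\<bar>y $ j - x $ j\<bar> = 1" by simp
  ultimately show ?thesis using that by blast
qed

lemma adjacentI:
  assumes "x \<in> sites" "y \<in> sites" "\<bar>y $ j - x $ j\<bar> = 1" "\<And>i. i \<noteq> j \<Longrightarrow> y $ i = x $ i"
  shows "adjacent x y"
proof -
  have "l1_norm (y - x) - l1_norm (0::real^'a) = \<bar>(y - x) $ j\<bar> - \<bar>(0::real^'a) $ j\<bar>"
    by (rule l1_norm_diff_coord) (auto simp: assms)
  then show ?thesis using assms by (simp add: adjacent_def)
qed

text \<open>Consecutive integers never have equal absolute values, so every step is either outward
  or inward.\<close>

lemma adjacent_l1_norm: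
  assumes "adjacent x y"
  shows "l1_norm y = l1_norm x + 1 \<or> l1_norm y = l1_norm x - 1"
proof -
  obtain j where j: "\<bar>y $ j - x $ j\<bar> = 1" "\<And>i. i \<noteq> j \<Longrightarrow> y $ i = x $ i"
    using adjacentE[OF assms] by metis
  have "l1_norm y - l1_norm x = \<bar>y $ j\<bar> - \<bar>x $ j\<bar>"
    by (rule l1_norm_diff_coord) (auto simp: j)
  moreover obtain a b where "y $ j = of_int a" "x $ j = of_int b"
    using assms by (auto simp: adjacent_def mem_sites Ints_def) (metis rangeE)
  then have "\<bar>y $ j\<bar> - \<bar>x $ j\<bar> = 1 \<or> \<bar>y $ j\<bar> - \<bar>x $ j\<bar> = -1"
    using j(1) by (simp flip: of_int_diff of_int_abs) linarith
  ultimately show ?thesis by linarith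
qed

section \<open>Recovering the two cubes from a plaquette\<close>

text \<open>The midpoint has one half-integer coordinate and integers elsewhere, which leaves
  exactly two sites within 1/2 of it in every coordinate.\<close>

lemma midpoint_in_unit_cube_iff:
  assumes "adjacent x y" "z \<in> sites"
  shows "midpoint x y \<in> unit_cube z \<longleftrightarrow> z = x \<or> z = y"
proof -
  obtain j where j: "\<bar>y $ j - x $ j\<bar> = 1" "\<And>i. i \<noteq> j \<Longrightarrow> y $ i = x $ i"
    using adjacentE[OF assms(1)] by metis
  have xy: "x \<in> sites" "y \<in> sites" using assms by (auto simp: adjacent_def)
  have m: "midpoint x y $ i = (x $ i + y $ i) / 2" for i
    by (simp add: midpoint_def)
  show ?thesis
  proof
    assume *: "midpoint x y \<in> unit_cube z"
    have off: "z $ i = x $ i" if "i \<noteq> j" for i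
    proof (rule Ints_abs_lt1_eq)
      have "\<bar>midpoint x y $ i - z $ i\<bar> \<le> 1/2" using * by (simp add: mem_unit_cube)
      then show "\<bar>z $ i - x $ i\<bar> < 1" unfolding m j(2)[OF that] by (simp add: abs_minus_commute)
    qed (use assms xy in \<open>auto simp: mem_sites\<close>)
    have "\<bar>(x $ j + y $ j) / 2 - z $ j\<bar> \<le> 1/2"
      using * unfolding mem_unit_cube m by blast
    moreover obtain a b c where "y $ j = of_int a" "x $ j = of_int b" "z $ j = of_int c"
      using assms xy by (auto simp: mem_sites Ints_def) (metis rangeE)
    ultimately have abc: "y $ j = of_int a" "x $ j = of_int b" "z $ j = of_int c"
      and "\<bar>real_of_int b + real_of_int a - 2 * real_of_int c\<bar> \<le> 1" "\<bar>real_of_int a - real_of_int b\<bar> = 1"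
      using j(1) by (simp_all add: abs_le_iff field_simps)
    then have "\<bar>b + a - 2 * c\<bar> \<le> 1" "\<bar>a - b\<bar> = 1" by linarith+
    then have "c = a \<or> c = b" by linarith
    with abc have "z $ j = x $ j \<or> z $ j = y $ j" by auto
    then show "z = x \<or> z = y" using off j by (metis vec_eq_iff)
  next
    assume "z = x \<or> z = y"
    then show "midpoint x y \<in> unit_cube z"
      unfolding mem_unit_cube m
    proof (intro allI)
      fix i assume "z = x \<or> z = y"
      then show "\<bar>(x $ i + y $ i) / 2 - z $ i\<bar> \<le> 1 / 2"
        using j(1) j(2)[of i] by (cases "i = j") (auto simp: abs_if field_simps split: if_splits)
    qed
  qed
qed

text \<open>The midpoint of \<open>x\<close> and \<open>y\<close> lies in the separator and in no
  cubes but those two, so the plaquette determines its pair of cubes.\<close>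

lemma separator_inj:
  assumes "adjacent x y" "adjacent x' y'" "separator x y = separator x' y'"
  shows "{x, y} = {x', y'}"
proof -
  have sub: "{a', b'} \<subseteq> {a, b}"
    if "adjacent a b" "adjacent a' b'" "separator a b = separator a' b'" for a b a' b' :: "real ^ 'a"
  proof -
    have "midpoint a b \<in> separator a b"
      using midpoint_in_unit_cube_iff[OF that(1)] that(1) by (auto simp: separator_def adjacent_def)
    then have "midpoint a b \<in> unit_cube a'" "midpoint a b \<in> unit_cube b'"
      using that by (auto simp: separator_def)
    then show ?thesis
      using midpoint_in_unit_cube_iff[OF that(1)] that(2) by (auto simp: adjacent_def)
  qed
  from sub[OF assms] sub[OF assms(2,1) assms(3)[symmetric]] show ?thesis by blast
qed

section \<open>Plaquettes as faces of cubes\<close>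

lemma convex_unit_cube: "convex (unit_cube z)"
  and compact_unit_cube: "compact (unit_cube z)"
  and polytope_unit_cube: "polytope (unit_cube z)"
  by (simp_all add: unit_cube_def polytope_interval)

text \<open>Argue by coordinates: where \<open>x\<close> and \<open>z\<close> differ, a common point
  of the cubes sits at an end of the interval around \<open>x $ i\<close>, and a proper convex
  combination reaches an end only if both its endpoints do. Disjoint cubes give the empty
  face.\<close>

lemma unit_cube_Int_face_of:
  assumes "x \<in> sites" "z \<in> sites"
  shows "unit_cube x \<inter> unit_cube z face_of unit_cube x"
  unfolding face_of_def
proof (intro conjI ballI impI)
  show "convex (unit_cube x \<inter> unit_cube z)"
    by (simp add: convex_Int convex_unit_cube)
  fix a b v
  assume a: "a \<in> unit_cube x" and b: "b \<in> unit_cube x" and v: "v \<in> unit_cube x \<inter> unit_cube z"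
    and seg: "v \<in> open_segment a b"
  obtain u where u: "0 < u" "u < 1" "v = (1 - u) *\<^sub>R a + u *\<^sub>R b"
    using seg by (auto simp: in_segment)
  have key: "\<bar>a $ i - z $ i\<bar> \<le> 1/2 \<and> \<bar>b $ i - z $ i\<bar> \<le> 1/2" for i
  proof -
    have ai: "\<bar>a $ i - x $ i\<bar> \<le> 1/2" and bi: "\<bar>b $ i - x $ i\<bar> \<le> 1/2"
      and vi: "\<bar>v $ i - x $ i\<bar> \<le> 1/2" "\<bar>v $ i - z $ i\<bar> \<le> 1/2"
      using a b v by (auto simp: mem_unit_cube)
    have vc: "v $ i = (1 - u) * a $ i + u * b $ i" by (simp add: u)
    consider "z $ i = x $ i" | "z $ i \<ge> x $ i + 1" | "z $ i \<le> x $ i - 1"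
      using Ints_nonzero_abs_ge1[of "z $ i - x $ i"] assms by (force simp: mem_sites abs_if split: if_splits)
    then show ?thesis
    proof cases
      case 2
      then have e: "v $ i = x $ i + 1/2" "z $ i = x $ i + 1" using vi by (auto simp: abs_le_iff)
      have "(1 - u) * (x $ i + 1/2 - a $ i) + u * (x $ i + 1/2 - b $ i) = x $ i + 1/2 - v $ i"
        unfolding vc by algebra
      then have "(1 - u) * (x $ i + 1/2 - a $ i) + u * (x $ i + 1/2 - b $ i) = 0"
        using e by simp
      moreover have "(1 - u) * (x $ i + 1/2 - a $ i) \<ge> 0" "u * (x $ i + 1/2 - b $ i) \<ge> 0"
        using ai bi u by (intro mult_nonneg_nonneg; linarith)+
      ultimately have "(1 - u) * (x $ i + 1/2 - a $ i) = 0" "u * (x $ i + 1/2 - b $ i) = 0"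
        by linarith+
      then show ?thesis using u e by auto
    next
      case 3
      then have e: "v $ i = x $ i - 1/2" "z $ i = x $ i - 1" using vi by (auto simp: abs_le_iff)
      have "(1 - u) * (a $ i - (x $ i - 1/2)) + u * (b $ i - (x $ i - 1/2)) = v $ i - (x $ i - 1/2)"
        unfolding vc by algebra
      then have "(1 - u) * (a $ i - (x $ i - 1/2)) + u * (b $ i - (x $ i - 1/2)) = 0"
        using e by simp
      moreover have "(1 - u) * (a $ i - (x $ i - 1/2)) \<ge> 0" "u * (b $ i - (x $ i - 1/2)) \<ge> 0"
        using ai bi u by (intro mult_nonneg_nonneg; linarith)+
      ultimately have "(1 - u) * (a $ i - (x $ i - 1/2)) = 0" "u * (b $ i - (x $ i - 1/2)) = 0"
        by linarith+
      then show ?thesis using u e by auto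
    qed (use ai bi in auto)
  qed
  then show "a \<in> unit_cube x \<inter> unit_cube z" "b \<in> unit_cube x \<inter> unit_cube z"
    using a b by (auto simp: mem_unit_cube)
qed auto

text \<open>The face property is \<open>unit_cube_Int_face_of\<close>. The dimension comes from
  viewing the separator as a hyperplane section of a third cube.\<close>

lemma separator_in_plaquettes:
  fixes x y :: "real ^ 'd::finite"
  assumes "adjacent x y"
  shows "separator x y \<in> plaquettes"
proof -
  obtain j where j: "\<bar>y $ j - x $ j\<bar> = 1" "\<And>i. i \<noteq> j \<Longrightarrow> y $ i = x $ i"
    using adjacentE[OF assms(1)] by metis
  have xy: "x \<in> sites" "y \<in> sites" using assms by (auto simp: adjacent_def)
  define m where "m = midpoint x y"
  have m: "m $ i = (x $ i + y $ i) / 2" for i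
    by (simp add: midpoint_def m_def)
  define H where "H = {v :: real ^ 'd. axis j 1 \<bullet> v = m $ j}"
  have H: "v \<in> H \<longleftrightarrow> v $ j = m $ j" for v
    by (simp add: H_def inner_axis')
  \<comment> \<open>\<open>H\<close> only touches the boundary of the cubes at \<open>x\<close> and
    \<open>y\<close>, but it passes through the centre of the cube at \<open>m\<close>, so the
    section has the same affine hull as \<open>H\<close>.\<close>
  have eq: "separator x y = H \<inter> unit_cube m"
  proof (rule set_eqI)
    fix v
    have "(\<bar>v $ i - x $ i\<bar> \<le> 1/2 \<and> \<bar>v $ i - y $ i\<bar> \<le> 1/2) \<longleftrightarrow>
          ((i = j \<longrightarrow> v $ i = m $ i) \<and> \<bar>v $ i - m $ i\<bar> \<le> 1/2)" for i
      using j(1) j(2)[of i] by (cases "i = j") (auto simp: m abs_if field_simps split: if_splits)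
    then show "v \<in> separator x y \<longleftrightarrow> v \<in> H \<inter> unit_cube m"
      by (auto simp: separator_def mem_unit_cube H)
  qed
  have "H \<inter> interior (unit_cube m) \<noteq> {}"
    using interior_unit_cube[of m m] H[of m] by auto
  then have "affine hull (separator x y) = affine hull H"
    unfolding eq by (intro affine_hull_convex_Int_nonempty_interior) (auto simp: H_def convex_hyperplane)
  then have "aff_dim (separator x y) = aff_dim H"
    by (metis aff_dim_affine_hull)
  also have "\<dots> = int DIM(real ^ 'd) - 1"
    unfolding H_def by (subst aff_dim_hyperplane) (simp_all add: axis_eq_0_iff)
  finally have "aff_dim (separator x y) = int DIM(real ^ 'd) - 1" .
  moreover have "aff_dim (unit_cube x) = int DIM(real ^ 'd)"
  proof -
    have "interior (unit_cube x) \<noteq> {}" using interior_unit_cube[of x x] by auto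
    then show ?thesis by (simp add: aff_dim_nonempty_interior)
  qed
  moreover have "separator x y \<noteq> {}"
    using midpoint_in_unit_cube_iff[OF assms] xy by (auto simp: separator_def)
  ultimately have "separator x y facet_of unit_cube x"
    using unit_cube_Int_face_of[OF xy] by (simp add: facet_of_def separator_def)
  then show ?thesis using xy by (auto simp: plaquettes_def)
qed

text \<open>The intersection is an intersection of faces of \<open>unit_cube x\<close>, hence itself
  such a face, and it stays a face of any smaller set containing it. This is the condition for a
  cell complex.\<close>

lemma separator_Int_face_of:
  assumes "adjacent x y" "adjacent x' y'"
  shows "separator x y \<inter> separator x' y' face_of separator x y"
proof -
  have s: "x \<in> sites" "y \<in> sites" "x' \<in> sites" "y' \<in> sites" using assms by (auto simp: adjacent_def)
  have "(unit_cube x \<inter> unit_cube y) \<inter> ((unit_cube x \<inter> unit_cube x') \<inter> (unit_cube x \<inter> unit_cube y'))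
      face_of unit_cube x"
    by (intro face_of_Int unit_cube_Int_face_of s)
  also have "(unit_cube x \<inter> unit_cube y) \<inter> ((unit_cube x \<inter> unit_cube x') \<inter> (unit_cube x \<inter> unit_cube y'))
     = separator x y \<inter> separator x' y'"
    by (auto simp: separator_def)
  finally show ?thesis
    by (rule face_of_subset) (auto simp: separator_def)
qed

lemma finite_sites_l1_ball: "finite {z \<in> sites. l1_norm (z :: real ^ 'd::finite) \<le> R}"
proof -
  let ?n = "\<lceil>R\<rceil>"
  let ?F = "PiE (UNIV :: 'd set) (\<lambda>_. {- ?n .. ?n})"
  have "{z \<in> sites. l1_norm (z :: real ^ 'd) \<le> R} \<subseteq> (\<lambda>f. \<chi> i. real_of_int (f i)) ` ?F"
  proof
    fix z :: "real ^ 'd" assume z: "z \<in> {z \<in> sites. l1_norm z \<le> R}"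
    have 1: "real_of_int \<lfloor>z $ i\<rfloor> = z $ i" for i using z by (auto simp: mem_sites)
    have "\<bar>z $ i\<bar> \<le> R" for i using component_le_l1_norm[of z i] z by auto
    then have "\<lfloor>z $ i\<rfloor> \<in> {- ?n .. ?n}" for i using 1[of i]
      by (smt (verit) atLeastAtMost_iff ceiling_minus floor_mono le_of_int_ceiling of_int_le_iff of_int_minus)
    then have "(\<lambda>i. \<lfloor>z $ i\<rfloor>) \<in> ?F" by auto
    moreover have "z = (\<chi> i. real_of_int \<lfloor>z $ i\<rfloor>)" by (simp add: 1 vec_eq_iff)
    ultimately show "z \<in> (\<lambda>f. \<chi> i. real_of_int (f i)) ` ?F" by (intro image_eqI)
  qed
  then show ?thesis by (rule finite_subset) (auto intro!: finite_PiE)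
qed

lemma countable_sites: "countable (sites :: (real ^ 'd::finite) set)"
proof -
  have "sites = (\<Union>n::nat. {z \<in> sites. l1_norm (z :: real ^ 'd) \<le> n})"
    by (simp add: set_eq_iff real_arch_simple)
  also have "countable \<dots>"
    by (intro countable_UN countable_finite[OF finite_sites_l1_ball]) auto
  finally show ?thesis .
qed

section \<open>The boundary of an inward-closed set of sites\<close>

text \<open>The one-dimensional core of star-shapedness. The bounds place \<open>t\<close> in the
  hull of the unit intervals around 0 and \<open>c\<close>; the equation of absolute values encodes
  that \<open>m\<close> lies between 0 and \<open>c\<close>.\<close>

lemma integer_near_between:
  fixes t c :: real
  assumes "c \<in> \<int>" "min (-1/2) (c - 1/2) \<le> t" "t \<le> max (1/2) (c + 1/2)"
  obtains m where "m \<in> \<int>" "\<bar>c\<bar> = \<bar>m\<bar> + \<bar>c - m\<bar>" "\<bar>t - m\<bar> \<le> 1/2"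
proof -
  have pos: "\<exists>m. m \<in> \<int> \<and> 0 \<le> m \<and> m \<le> e \<and> \<bar>s - m\<bar> \<le> 1/2"
    if "e \<in> \<int>" "0 \<le> e" "-1/2 \<le> s" "s \<le> e + 1/2" for s e :: real
  proof (intro exI conjI)
    \<comment> \<open>The ceiling is the least integer within 1/2 of \<open>s\<close>; the maximum
      with 0 corrects it only at \<open>s = -1/2\<close>.\<close>
    let ?m = "max 0 \<lceil>s - 1/2\<rceil>"
    from that(1) obtain k where k: "e = of_int k" by (auto elim: Ints_cases)
    have "\<lceil>s - 1/2\<rceil> \<le> k" using that(4) unfolding k by (simp add: ceiling_le_iff)
    then show "real_of_int ?m \<le> e" using that(2) unfolding k by simp
    have "s - 1/2 \<le> of_int \<lceil>s - 1/2\<rceil>" "of_int \<lceil>s - 1/2\<rceil> < s + 1/2" by linarith+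
    then show "\<bar>s - real_of_int ?m\<bar> \<le> 1/2"
      using that(3) unfolding of_int_max of_int_0 by linarith
  qed auto
  show ?thesis
  proof (cases "c \<ge> 0")
    case True
    with pos[of c t] assms obtain m where "m \<in> \<int>" "0 \<le> m" "m \<le> c" "\<bar>t - m\<bar> \<le> 1/2"
      by (auto simp: min_def max_def split: if_splits)
    with that[of m] show ?thesis by auto
  next
    case False
    \<comment> \<open>Negative \<open>c\<close> is treated by reflection through 0.\<close>
    with pos[of "-c" "-t"] assms obtain m where "m \<in> \<int>" "0 \<le> m" "m \<le> -c" "\<bar>- t - m\<bar> \<le> 1/2"
      by (auto simp: min_def max_def split: if_splits)
    with that[of "-m"] show ?thesis by (auto simp: abs_if split: if_splits)
  qed
qed

lemma nearby_site:
  fixes v :: "real ^ 'd::finite"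
  obtains z where "z \<in> sites" "v \<in> unit_cube z"
proof
  show "(\<chi> i. real_of_int (round (v $ i))) \<in> sites" by (simp add: mem_sites)
  show "v \<in> unit_cube (\<chi> i. real_of_int (round (v $ i)))"
    using of_int_round_abs_le by (auto simp: mem_unit_cube abs_minus_commute)
qed

lemma l1_norm_bound_unit_cube:
  fixes v :: "real ^ 'd::finite"
  assumes "v \<in> unit_cube z"
  shows "\<bar>l1_norm v - l1_norm z\<bar> \<le> CARD('d) / 2"
proof -
  have "\<bar>l1_norm v - l1_norm z\<bar> \<le> (\<Sum>i\<in>UNIV. \<bar>\<bar>v $ i\<bar> - \<bar>z $ i\<bar>\<bar>)"
    unfolding l1_norm_def sum_subtractf[symmetric] by (rule sum_abs)
  also have "\<dots> \<le> (\<Sum>i\<in>(UNIV::'d set). 1/2)"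
  proof (rule sum_mono)
    fix i
    have "\<bar>v $ i - z $ i\<bar> \<le> 1/2" using assms by (simp add: mem_unit_cube)
    then show "\<bar>\<bar>v $ i\<bar> - \<bar>z $ i\<bar>\<bar> \<le> 1/2" by linarith
  qed
  finally show ?thesis by simp
qed

text \<open>Only finitely many cubes come near \<open>v\<close>; those missing \<open>v\<close> are
  closed and can be removed from a box around it.\<close>

lemma locally_finite_unit_cubes:
  fixes v :: "real ^ 'd::finite"
  obtains V where "open V" "v \<in> V"
    "\<And>w z. w \<in> V \<Longrightarrow> z \<in> sites \<Longrightarrow> w \<in> unit_cube z \<Longrightarrow> v \<in> unit_cube z"
proof -
  \<comment> \<open>Moving within the box adds at most \<open>CARD('d)\<close> to the norm, and
    passing to the centre of a cube at most half of that.\<close>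
  define R where "R = l1_norm v + CARD('d) + CARD('d) / 2"
  define F where "F = {z \<in> sites. l1_norm z \<le> R \<and> v \<notin> unit_cube z}"
  have "finite F" by (rule finite_subset[OF _ finite_sites_l1_ball[of R]]) (auto simp: F_def)
  define V where "V = interior (cbox (v - 1) (v + 1)) - (\<Union>z\<in>F. unit_cube z)"
  show ?thesis
  proof
    show "open V" unfolding V_def
      using \<open>finite F\<close> by (intro open_Diff open_interior closed_UN) (auto intro: compact_imp_closed compact_unit_cube)
    show "v \<in> V" by (auto simp: V_def F_def interior_cbox mem_box_cart)
  next
    fix w z assume w: "w \<in> V" and z: "z \<in> sites" "w \<in> unit_cube z"
    have "\<bar>w $ i - v $ i\<bar> \<le> 1" for i
      using w by (auto simp: V_def interior_cbox mem_box_cart abs_le_iff algebra_simps less_imp_le)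
    then have "\<bar>w $ i\<bar> \<le> \<bar>v $ i\<bar> + 1" for i by (metis add.commute abs_triangle_ineq2 diff_le_eq order.trans)
    then have "l1_norm w \<le> (\<Sum>i\<in>UNIV. \<bar>v $ i\<bar> + 1)"
      unfolding l1_norm_def by (intro sum_mono)
    then have "l1_norm w \<le> l1_norm v + CARD('d)" by (simp add: sum.distrib l1_norm_def)
    then have "l1_norm z \<le> R"
      using l1_norm_bound_unit_cube[OF z(2)] unfolding R_def by linarith
    then show "v \<in> unit_cube z" using w z by (auto simp: V_def F_def)
  qed
qed

text \<open>Moving along the cubes that contain \<open>v\<close>, one coordinate at a time, a pair of cubes that
  is minimal in \<open>\<ell>\<^sup>1\<close>-distance must be adjacent.\<close>

lemma boundary_pair_adjacent:
  fixes D :: "(real ^ 'd::finite) set"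
  assumes "x \<in> sites" "z \<in> sites" "v \<in> unit_cube x" "v \<in> unit_cube z" "x \<in> D" "z \<notin> D"
  shows "\<exists>x y. adjacent x y \<and> v \<in> unit_cube x \<and> v \<in> unit_cube y \<and> x \<in> D \<and> y \<notin> D"
proof -
  have "l1_norm (x - z) = real n \<Longrightarrow> ?thesis" if "x \<in> sites" "z \<in> sites" "v \<in> unit_cube x" "v \<in> unit_cube z" "x \<in> D" "z \<notin> D"
    for n x z
    using that
  proof (induction n arbitrary: x z rule: less_induct)
    case (less n)
    from less.prems obtain j where j: "x $ j \<noteq> z $ j" by (metis vec_eq_iff)
    define y where "y = (\<chi> i. if i = j then z $ j else x $ i)"
    have y: "y $ j = z $ j" "\<And>i. i \<noteq> j \<Longrightarrow> y $ i = x $ i" by (auto simp: y_def)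
    have ys: "y \<in> sites" "v \<in> unit_cube y"
      using less.prems by (auto simp: mem_sites mem_unit_cube y_def)
    have "\<bar>v $ j - x $ j\<bar> \<le> 1/2" "\<bar>v $ j - z $ j\<bar> \<le> 1/2"
      using less.prems by (auto simp: mem_unit_cube)
    then have "\<bar>z $ j - x $ j\<bar> \<le> 1" by linarith
    moreover have "\<bar>z $ j - x $ j\<bar> \<ge> 1"
      using less.prems j by (intro Ints_nonzero_abs_ge1) (auto simp: mem_sites)
    ultimately have d: "\<bar>z $ j - x $ j\<bar> = 1" by simp
    then have adj: "adjacent x y" using less.prems ys y by (intro adjacentI[of _ _ j]) auto
    show ?case
    proof (cases "y \<in> D")
      case False
      with adj ys less.prems show ?thesis by blast
    next
      case True
      have "l1_norm (y - z) - l1_norm (x - z) = \<bar>(y - z) $ j\<bar> - \<bar>(x - z) $ j\<bar>"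
        by (rule l1_norm_diff_coord) (simp add: y)
      also have "\<dots> = -1" using d y by simp
      finally have lt: "l1_norm (y - z) < real n" using less.prems(1) by simp
      obtain k where k: "l1_norm (y - z) = real k"
        using l1_norm_Nats[OF sites_diff[OF ys(1) less.prems(3)]] by blast
      show ?thesis by (rule less.IH[OF _ k ys(1) less.prems(3) ys(2) less.prems(5) True less.prems(7)])
          (use lt k in simp)
    qed
  qed
  moreover obtain n where "l1_norm (x - z) = real n"
    using l1_norm_Nats[OF sites_diff[OF assms(1,2)]] by blast
  ultimately show ?thesis using assms by blast
qed

definition body :: "(real ^ 'd::finite) set \<Rightarrow> (real ^ 'd) set" where
  "body D = (\<Union>z\<in>D. unit_cube z)"

definition surface :: "(real ^ 'd::finite) set \<Rightarrow> (real ^ 'd) set set" where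
  "surface D = {separator x y |x y. adjacent x y \<and> x \<in> D \<and> y \<notin> D}"

lemma surface_subset_plaquettes: "surface D \<subseteq> plaquettes"
  by (auto simp: surface_def separator_in_plaquettes)

lemma finite_surface:
  assumes "finite D"
  shows "finite (surface D)"
proof -
  obtain R where R: "\<And>x. x \<in> D \<Longrightarrow> l1_norm x \<le> R"
    using assms by (metis bdd_above.unfold bdd_above_finite finite_imageI image_eqI)
  have "surface D \<subseteq> (\<lambda>(x, y). separator x y) ` (D \<times> {z \<in> sites. l1_norm z \<le> R + 1})"
    using R adjacent_l1_norm by (fastforce simp: surface_def adjacent_def)
  then show ?thesis
    by (rule finite_subset) (intro finite_imageI finite_SigmaI assms finite_sites_l1_ball)
qed

section \<open>Star-shaped bodies and their boundary spheres\<close>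

text \<open>What the geometry uses of a finite cluster, stated without probability.\<close>

locale inward_closed =
  fixes D :: "(real ^ 'd::finite) set"
  assumes finite: "finite D"
    and sub_sites: "D \<subseteq> sites"
    and zero_mem: "0 \<in> D"
    and inward: "\<And>x y. x \<in> D \<Longrightarrow> adjacent x y \<Longrightarrow> l1_norm y < l1_norm x \<Longrightarrow> y \<in> D"
begin

text \<open>The last assumption says that each \<open>w $ i\<close> lies between 0 and
  \<open>z $ i\<close>. Hence \<open>w\<close> is reached from \<open>z\<close> by unit steps that
  all decrease the norm, and \<open>inward\<close> applies to each.\<close>

lemma between_mem:
  assumes "z \<in> D" "w \<in> sites" "\<And>i. \<bar>z $ i\<bar> = \<bar>w $ i\<bar> + \<bar>z $ i - w $ i\<bar>"
  shows "w \<in> D"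
proof -
  have "l1_norm z = real n \<Longrightarrow> w \<in> D" if "z \<in> D" "\<And>i. \<bar>z $ i\<bar> = \<bar>w $ i\<bar> + \<bar>z $ i - w $ i\<bar>" for n z
    using that
  proof (induction n arbitrary: z rule: less_induct)
    case (less n)
    show ?case
    proof (cases "z = w")
      case False
      then obtain j where j: "z $ j \<noteq> w $ j" by (metis vec_eq_iff)
      have zs: "z \<in> sites" using less.prems sub_sites by auto
      have ge: "\<bar>z $ j - w $ j\<bar> \<ge> 1"
        using zs assms(2) j by (intro Ints_nonzero_abs_ge1) (auto simp: mem_sites)
      have bj: "\<bar>z $ j\<bar> = \<bar>w $ j\<bar> + \<bar>z $ j - w $ j\<bar>" by (rule less.prems)
      \<comment> \<open>One unit towards 0 in a coordinate where \<open>z\<close> and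
        \<open>w\<close> differ; by integrality this does not overshoot
        \<open>w $ j\<close>.\<close>
      define c where "c = z $ j - sgn (z $ j)"
      have "z $ j \<noteq> 0" using bj ge by auto
      then have c: "c \<in> \<int>" "\<bar>c - z $ j\<bar> = 1" "\<bar>c\<bar> = \<bar>w $ j\<bar> + \<bar>c - w $ j\<bar>" "\<bar>c\<bar> = \<bar>z $ j\<bar> - 1"
        using zs bj ge unfolding c_def by (auto simp: mem_sites sgn_if abs_if split: if_splits)
      define y where "y = (\<chi> i. if i = j then c else z $ i)"
      have y: "y $ j = c" "\<And>i. i \<noteq> j \<Longrightarrow> y $ i = z $ i" by (auto simp: y_def)
      have ys: "y \<in> sites" using zs c by (auto simp: mem_sites y_def)
      have adj: "adjacent z y" using zs ys y c by (intro adjacentI[of _ _ j]) auto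
      have "l1_norm y - l1_norm z = \<bar>y $ j\<bar> - \<bar>z $ j\<bar>"
        by (rule l1_norm_diff_coord) (simp add: y)
      then have lt: "l1_norm y = l1_norm z - 1" using c y by simp
      then have "y \<in> D" using inward[OF less.prems(2) adj] by simp
      obtain k where k: "l1_norm y = real k" using l1_norm_Nats[OF ys] by blast
      show ?thesis
      proof (rule less.IH[OF _ k \<open>y \<in> D\<close>])
        show "k < n" using lt k less.prems(1) by simp
        show "\<bar>y $ i\<bar> = \<bar>w $ i\<bar> + \<bar>y $ i - w $ i\<bar>" for i
          using less.prems(3)[of i] c y by (cases "i = j") auto
      qed
    qed (use less.prems in simp)
  qed
  moreover obtain n where "l1_norm z = real n"
    using l1_norm_Nats assms(1) sub_sites by blast
  ultimately show ?thesis using assms by blast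
qed

lemma compact_body: "compact (body D)"
  unfolding body_def using finite by (intro compact_UN) (auto intro: compact_unit_cube)

lemma zero_interior_body: "0 \<in> interior (body D)"
proof -
  have "unit_cube 0 \<subseteq> body D" using zero_mem by (auto simp: body_def)
  moreover have "0 \<in> interior (unit_cube (0 :: real ^ 'd))" by (simp add: interior_unit_cube)
  ultimately show ?thesis using interior_mono by blast
qed

text \<open>Every cube of the body lies in a box inside the body that contains \<open>0\<close> in its interior.\<close>

lemma open_segment_subset_interior_body:
  assumes "v \<in> body D"
  shows "open_segment 0 v \<subseteq> interior (body D)"
proof -
  obtain z where z: "z \<in> D" "v \<in> unit_cube z" using assms by (auto simp: body_def)
  then have zs: "z \<in> sites" using sub_sites by auto
  define B where "B = cbox (\<chi> i. min (-1/2) (z $ i - 1/2)) (\<chi> i. max (1/2) (z $ i + 1/2))"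
  have "B \<subseteq> body D"
  proof
    fix w assume w: "w \<in> B"
    have "\<exists>m. m \<in> \<int> \<and> \<bar>z $ i\<bar> = \<bar>m\<bar> + \<bar>z $ i - m\<bar> \<and> \<bar>w $ i - m\<bar> \<le> 1/2" for i
    proof (rule integer_near_between[of "z $ i" "w $ i"])
      show "z $ i \<in> \<int>" using zs by (simp add: mem_sites)
      show "min (- 1 / 2) (z $ i - 1 / 2) \<le> w $ i" "w $ i \<le> max (1 / 2) (z $ i + 1 / 2)"
        using w unfolding B_def mem_box_cart vec_lambda_beta by blast+
    qed blast
    then obtain m where m: "\<And>i. m i \<in> \<int>" "\<And>i. \<bar>z $ i\<bar> = \<bar>m i\<bar> + \<bar>z $ i - m i\<bar>" "\<And>i. \<bar>w $ i - m i\<bar> \<le> 1/2"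
      by metis
    have "(\<chi> i. m i) \<in> D" by (rule between_mem[OF z(1)]) (use m in \<open>auto simp: mem_sites\<close>)
    moreover have "w \<in> unit_cube (\<chi> i. m i)" using m by (simp add: mem_unit_cube)
    ultimately show "w \<in> body D" by (auto simp: body_def)
  qed
  have "min (-1/2) a < 0" "0 < max (1/2) a" for a :: real by auto
  then have 0: "0 \<in> interior B" by (simp add: B_def interior_cbox mem_box_cart)
  have "v \<in> B"
    using z(2) unfolding B_def mem_box_cart mem_unit_cube vec_lambda_beta
    by (smt (verit, best) min.cobounded2 max.cobounded2)
  then have "open_segment 0 v \<subseteq> interior B"
    using in_interior_closure_convex_segment[OF _ 0, of v] closure_subset by (auto simp: B_def)
  with \<open>B \<subseteq> body D\<close> show ?thesis using interior_mono by blast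
qed

text \<open>A point on a plaquette is a limit of interior points of a cube outside \<open>D\<close>,
  and these avoid the body. Conversely, a frontier point has points outside the body nearby, and
  local finiteness puts it in a cube whose centre is not in \<open>D\<close>.\<close>

lemma Union_surface: "\<Union>(surface D) = frontier (body D)"
proof (intro equalityI subsetI)
  fix v assume "v \<in> \<Union>(surface D)"
  then obtain x y where xy: "adjacent x y" "x \<in> D" "y \<notin> D" "v \<in> unit_cube x" "v \<in> unit_cube y"
    by (auto simp: surface_def separator_def)
  have "v \<notin> interior (body D)"
  proof
    assume "v \<in> interior (body D)"
    \<comment> \<open>Some interior point of the cube at \<open>y\<close> would lie in the body,
      hence in a cube at \<open>z\<close> with all coordinates less than 1 away from
      \<open>y\<close>; integrality forces \<open>z = y\<close>.\<close>
    moreover have "v \<in> closure (interior (unit_cube y))"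
    proof -
      have "interior (unit_cube y) \<noteq> {}" using interior_unit_cube[of y y] by auto
      then have "closure (interior (unit_cube y)) = closure (unit_cube y)"
        by (intro convex_closure_interior convex_unit_cube)
      then show ?thesis using xy closure_subset by blast
    qed
    ultimately obtain w where "w \<in> interior (unit_cube y)" "w \<in> interior (body D)"
      by (metis open_interior open_Int_closure_eq_empty disjoint_iff Int_commute)
    then obtain z where z: "z \<in> D" "w \<in> unit_cube z" and w: "\<And>i. \<bar>w $ i - y $ i\<bar> < 1/2"
      using interior_subset[of "body D"] unfolding body_def interior_unit_cube by blast
    have "z $ i = y $ i" for i
    proof (rule Ints_abs_lt1_eq)
      have "\<bar>w $ i - z $ i\<bar> \<le> 1/2" using z by (simp add: mem_unit_cube)
      with w[of i] show "\<bar>z $ i - y $ i\<bar> < 1" by linarith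
    qed (use z sub_sites xy in \<open>auto simp: mem_sites adjacent_def\<close>)
    then have "z = y" by (simp add: vec_eq_iff)
    with z xy show False by simp
  qed
  moreover have "v \<in> body D" using xy by (auto simp: body_def)
  ultimately show "v \<in> frontier (body D)" using closure_subset by (auto simp: frontier_def)
next
  fix v assume v: "v \<in> frontier (body D)"
  then have "v \<in> body D" "v \<notin> interior (body D)"
    using compact_body by (auto simp: frontier_def compact_imp_closed)
  then obtain x where x: "x \<in> D" "v \<in> unit_cube x" by (auto simp: body_def)
  obtain V where V: "open V" "v \<in> V"
    "\<And>w z. w \<in> V \<Longrightarrow> z \<in> sites \<Longrightarrow> w \<in> unit_cube z \<Longrightarrow> v \<in> unit_cube z"
    using locally_finite_unit_cubes by metis
  have "\<not> V \<subseteq> body D" using V \<open>v \<notin> interior (body D)\<close> by (meson interiorI)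
  then obtain w where w: "w \<in> V" "w \<notin> body D" by blast
  obtain z where z: "z \<in> sites" "w \<in> unit_cube z" using nearby_site by metis
  then have "z \<notin> D" "v \<in> unit_cube z" using w V by (auto simp: body_def)
  with boundary_pair_adjacent[of x z v D] x z sub_sites
  obtain x y where "adjacent x y" "v \<in> unit_cube x" "v \<in> unit_cube y" "x \<in> D" "y \<notin> D" by blast
  then show "v \<in> \<Union>(surface D)" by (auto simp: surface_def separator_def)
qed

text \<open>Open segments from 0 to the body stay in its interior, so radial projection from 0 is
  the homeomorphism. As 0 is an interior point, the relative interior and affine hull in the
  projection theorem become the interior and the whole space.\<close>

lemma surface_homeomorphic_sphere: "\<Union>(surface D) homeomorphic sphere (0 :: real ^ 'd) 1"
proof -
  have ri: "rel_interior (body D) = interior (body D)"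
    using zero_interior_body by (intro rel_interior_nonempty_interior) auto
  have "affine hull (body D) = UNIV"
    using zero_interior_body by (intro affine_hull_nonempty_interior) auto
  moreover have "body D - rel_interior (body D) homeomorphic sphere 0 1 \<inter> affine hull (body D)"
    by (rule starlike_compact_projective1_0)
      (auto simp: ri compact_body zero_interior_body dest: open_segment_subset_interior_body[THEN subsetD])
  moreover have "\<Union>(surface D) = body D - rel_interior (body D)"
    unfolding Union_surface ri frontier_def using compact_body by (simp add: compact_imp_closed)
  ultimately show ?thesis by simp
qed

text \<open>The plaquettes are finitely many polytopes meeting in common faces, and such a cell
  complex has a simplicial subdivision.\<close>

lemma is_sphere_surface: "is_sphere (\<Union>(surface D))"
proof -
  obtain \<T> where "simplicial_complex \<T>" "\<Union>\<T> = \<Union>(surface D)"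
  proof (rule simplicial_subdivision_of_cell_complex[OF finite_surface[OF finite]])
    show "polytope C" if "C \<in> surface D" for C
      using that unfolding surface_def separator_def by (auto intro: polytope_Int polytope_unit_cube)
    show "C1 \<inter> C2 face_of C1" if "C1 \<in> surface D" "C2 \<in> surface D" for C1 C2
      using that unfolding surface_def by (auto intro: separator_Int_face_of)
  qed
  then show ?thesis unfolding is_sphere_def using surface_homeomorphic_sphere by metis
qed

lemma zero_inside_surface: "0 \<in> inside (\<Union>(surface D))"
  using interior_inside_frontier[OF compact_imp_bounded[OF compact_body]] zero_interior_body
  by (auto simp: Union_surface)

end

section \<open>Self-avoiding paths\<close>

text \<open>Fekete's lemma in multiplicative form: the limit is the infimum of the roots.\<close>

lemma submultiplicative_root_convergent:
  fixes s :: "nat \<Rightarrow> real"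
  assumes ge1: "\<And>k. 1 \<le> s k" and sub: "\<And>m n. s (m + n) \<le> s m * s n"
  shows "convergent (\<lambda>k. root k (s k))"
proof -
  \<comment> \<open>Index 0 is excluded because \<open>root 0\<close> is 0 by convention.\<close>
  define L where "L = (INF k\<in>{1..}. root k (s k))"
  have bdd: "bdd_below ((\<lambda>k. root k (s k)) ` {1..})"
    using ge1 by (intro bdd_belowI2[of _ 0]) (auto intro: real_root_ge_zero order_trans[OF zero_le_one])
  have "(\<lambda>k. root k (s k)) \<longlonglongrightarrow> L"
  proof (rule order_tendstoI)
    fix a assume "a < L"
    have "a < root k (s k)" if "k \<ge> 1" for k
      using cINF_lower[OF bdd, of k] that \<open>a < L\<close> by (simp add: L_def)
    then show "\<forall>\<^sub>F k in sequentially. a < root k (s k)"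
      by (auto simp: eventually_sequentially)
  next
    fix a assume "L < a"
    then obtain m where m: "m \<ge> 1" "root m (s m) < a"
      using cINF_less_iff[OF _ bdd] by (auto simp: L_def)
    define b where "b = root m (s m)"
    have b: "b \<ge> 1" "b ^ m = s m"
      using m ge1[of m] by (auto simp: b_def intro: real_root_pow_pos2 order_trans[OF zero_le_one])
    \<comment> \<open>Writing \<open>k\<close> as a multiple of \<open>m\<close> plus a remainder,
      \<open>K\<close> bounds the contribution of the remainder; its \<open>k\<close>-th root tends
      to 1.\<close>
    define K where "K = Max (s ` {..<m})"
    have sK: "s r \<le> K" if "r < m" for r unfolding K_def using that by (intro Max_ge) auto
    then have K: "K \<ge> 1" using ge1[of 0] m by (meson less_le_trans order_trans zero_less_one)
    have mult: "s (q * m + r) \<le> s m ^ q * s r" for q r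
    proof (induction q)
      case (Suc q)
      have "s (Suc q * m + r) \<le> s m * s (q * m + r)" using sub[of m "q * m + r"] by (simp add: add.assoc)
      also have "\<dots> \<le> s m * (s m ^ q * s r)"
        using Suc ge1[of m] by (intro mult_left_mono) auto
      finally show ?case by (simp add: mult.assoc)
    qed simp
    have le: "s k \<le> b ^ k * K" for k
    proof -
      have "s k \<le> s m ^ (k div m) * s (k mod m)" using mult[of "k div m" "k mod m"] by simp
      also have "s m ^ (k div m) = b ^ (k div m * m)"
        unfolding b(2)[symmetric] by (simp add: power_mult[symmetric] mult.commute)
      also have "\<dots> * s (k mod m) \<le> b ^ k * K"
        using b m ge1[of "k mod m"] sK[of "k mod m"]
        by (intro mult_mono power_increasing) (auto simp: order_trans[OF zero_le_one])
      finally show ?thesis .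
    qed
    have "root k (s k) \<le> b * root k K" if "k \<ge> 1" for k
    proof -
      have "root k (s k) \<le> root k (b ^ k * K)" using that le by simp
      also have "\<dots> = b * root k K" using that b K
        by (simp add: real_root_mult real_root_power_cancel)
      finally show ?thesis .
    qed
    moreover have "(\<lambda>k. b * root k K) \<longlonglongrightarrow> b * 1"
      using K by (intro tendsto_mult tendsto_const LIMSEQ_root_const) auto
    then have "\<forall>\<^sub>F k in sequentially. b * root k K < a"
      using m by (intro order_tendstoD) (auto simp: b_def)
    then have "\<forall>\<^sub>F k in sequentially. k \<ge> 1 \<and> b * root k K < a"
      by (intro eventually_conj eventually_ge_at_top)
    ultimately show "\<forall>\<^sub>F k in sequentially. root k (s k) < a"
      by (elim eventually_mono) (meson le_less_trans)
  qed
  then show ?thesis by (rule convergentI)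
qed

text \<open>Eventually \<open>s k\<close> is below \<open>l ^ k\<close>; the finitely many earlier
  terms are absorbed into \<open>K\<close>.\<close>

lemma geometric_bound_of_root_limit:
  fixes s :: "nat \<Rightarrow> real"
  assumes "\<And>k. 0 \<le> s k" "(\<lambda>k. root k (s k)) \<longlonglongrightarrow> L" "L < l" "0 < l"
  obtains K where "0 < K" "\<And>k. s k \<le> K * l ^ k"
proof -
  have "\<forall>\<^sub>F k in sequentially. k \<ge> 1 \<and> root k (s k) < l"
    using assms by (intro eventually_conj eventually_ge_at_top order_tendstoD)
  then obtain N where N: "\<And>k. k \<ge> N \<Longrightarrow> k \<ge> 1 \<and> root k (s k) < l"
    unfolding eventually_sequentially by blast
  \<comment> \<open>The 1 covers indices from \<open>N\<close> on, the sum those below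
    \<open>N\<close>.\<close>
  define K where "K = 1 + (\<Sum>k<N. s k / l ^ k)"
  have nn: "0 \<le> (\<Sum>k<N. s k / l ^ k)" using assms by (intro sum_nonneg) auto
  show ?thesis
  proof
    show "0 < K" using nn by (simp add: K_def)
    show "s k \<le> K * l ^ k" for k
    proof (cases "k < N")
      case True
      have "s k / l ^ k \<le> (\<Sum>k<N. s k / l ^ k)"
        using True assms by (intro member_le_sum) auto
      then have "s k \<le> (\<Sum>k<N. s k / l ^ k) * l ^ k" using assms by (simp add: field_simps)
      also have "\<dots> \<le> K * l ^ k" using assms by (intro mult_right_mono) (auto simp: K_def)
      finally show ?thesis .
    next
      case False
      then have "s k = root k (s k) ^ k" using N[of k] assms by (simp add: real_root_pow_pos2)
      also have "\<dots> \<le> l ^ k" using False N[of k] assms by (intro power_mono) (auto simp: real_root_ge_zero)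
      also have "\<dots> \<le> K * l ^ k" using nn assms by (simp add: K_def)
      finally show ?thesis .
    qed
  qed
qed

section \<open>Counting self-avoiding paths\<close>

lemma self_avoiding_path_adjacent:
  assumes "w \<in> self_avoiding_paths k" "i < k"
  shows "adjacent (w ! i) (w ! Suc i)"
proof -
  have "w ! i \<in> set w" "w ! Suc i \<in> set w" using assms by (auto simp: self_avoiding_paths_def)
  then show ?thesis using assms by (auto simp: adjacent_def self_avoiding_paths_def)
qed

lemma self_avoiding_path_nth_0: "w \<in> self_avoiding_paths k \<Longrightarrow> w ! 0 = 0"
  unfolding self_avoiding_paths_def by (cases w) auto

lemma self_avoiding_path_l1_norm:
  assumes "w \<in> self_avoiding_paths k"
  shows "i \<le> k \<Longrightarrow> l1_norm (w ! i) \<le> real i"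
proof (induction i)
  case 0
  then show ?case using self_avoiding_path_nth_0[OF assms] by simp
next
  case (Suc i)
  then show ?case
    using adjacent_l1_norm[OF self_avoiding_path_adjacent[OF assms, of i]] by auto
qed

lemma finite_self_avoiding_paths: "finite (self_avoiding_paths k :: (real ^ 'd::finite) list set)"
proof (rule finite_subset)
  show "(self_avoiding_paths k :: (real ^ 'd) list set) \<subseteq>
      {w. set w \<subseteq> {z \<in> sites. l1_norm z \<le> real k} \<and> length w = k + 1}"
  proof safe
    fix w :: "(real ^ 'd) list" and z assume w: "w \<in> self_avoiding_paths k" and "z \<in> set w"
    then obtain i where "z = w ! i" "i \<le> k"
      by (auto simp: self_avoiding_paths_def in_set_conv_nth less_Suc_eq_le)
    then show "l1_norm z \<le> real k" using self_avoiding_path_l1_norm[OF w, of i] by simp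
  qed (auto simp: self_avoiding_paths_def)
  show "finite {w :: (real ^ 'd) list. set w \<subseteq> {z \<in> sites. l1_norm z \<le> real k} \<and> length w = k + 1}"
    by (rule finite_lists_length_eq[OF finite_sites_l1_ball])
qed

text \<open>A path along one axis exists in every length, so the counts are at least 1, as Fekete's
  lemma requires.\<close>

lemma straight_path: "map (\<lambda>i. axis j (real i)) [0..<k + 1] \<in> self_avoiding_paths k"
proof -
  have ax: "axis j (1 + real i) - axis j (real i) = axis j 1" for i
    by (simp add: vec_eq_iff axis_def)
  have "l1_norm (axis j 1 :: real ^ 'a) - l1_norm (0 :: real ^ 'a) = 1"
    by (subst l1_norm_diff_coord[of j]) (auto simp: axis_def)
  then have 1: "l1_norm (axis j 1 :: real ^ 'a) = 1" by simp
  have "hd (map (\<lambda>i. axis j (real i) :: real ^ 'a) [0..<k + 1]) = 0"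
    by (simp add: hd_map upt_conv_Cons del: upt_Suc)
  moreover have "inj_on (\<lambda>i. axis j (real i) :: real ^ 'a) A" for A
    by (rule inj_onI) (auto simp: axis_eq_axis)
  moreover have "axis j (real i) \<in> sites" for i by (simp add: mem_sites axis_def)
  ultimately show ?thesis
    by (auto simp: self_avoiding_paths_def distinct_map ax 1 nth_append simp del: upt_Suc)
qed

lemma card_self_avoiding_paths_ge1: "1 \<le> card (self_avoiding_paths k :: (real ^ 'd::finite) list set)"
  \<comment> \<open>\<open>undefined\<close> stands for an arbitrary coordinate direction.\<close>
  using straight_path[of undefined k] finite_self_avoiding_paths[of k]
  by (metis One_nat_def Suc_leI card_gt_0_iff empty_iff)

text \<open>Cut the path after \<open>m\<close> steps and translate the second piece to the origin.\<close>

lemma card_self_avoiding_paths_submult: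
  "card (self_avoiding_paths (m + n) :: (real ^ 'd::finite) list set) \<le>
     card (self_avoiding_paths m :: (real ^ 'd) list set) * card (self_avoiding_paths n :: (real ^ 'd) list set)"
proof -
  let ?P = "\<lambda>k. self_avoiding_paths k :: (real ^ 'd) list set"
  \<comment> \<open>The first piece keeps the site \<open>w ! m\<close>, so the translation of the
    second piece can be undone.\<close>
  define f where "f w = (take (m + 1) w, map (\<lambda>x. x - w ! m) (drop m w))" for w :: "(real ^ 'd) list"
  have "inj_on f (?P (m + n))"
  proof (rule inj_onI)
    fix w w' assume w: "w \<in> ?P (m + n)" "w' \<in> ?P (m + n)" and eq: "f w = f w'"
    have t: "take (m + 1) w = take (m + 1) w'" using eq by (simp add: f_def)
    have m: "w ! m = w' ! m" using arg_cong[OF t, of "\<lambda>l. l ! m"] by simp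
    have "map (\<lambda>x. x - w ! m) (drop m w) = map (\<lambda>x. x - w ! m) (drop m w')"
      using eq m by (simp add: f_def)
    then have "drop m w = drop m w'" by (rule map_injective) (simp add: inj_def)
    moreover have "take m w = take m w'"
      using arg_cong[OF t, of "take m"] by simp
    ultimately show "w = w'" by (metis append_take_drop_id)
  qed
  moreover have "f ` ?P (m + n) \<subseteq> ?P m \<times> ?P n"
  proof
    fix p assume "p \<in> f ` ?P (m + n)"
    then obtain w where w: "w \<in> ?P (m + n)" and p: "p = f w" by blast
    have len: "length w = m + n + 1" and hd: "hd w = 0" and s: "set w \<subseteq> sites" and d: "distinct w"
      and st: "\<And>i. i < m + n \<Longrightarrow> l1_norm (w ! Suc i - w ! i) = 1"
      using w by (auto simp: self_avoiding_paths_def)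
    have "take (m + 1) w \<in> ?P m"
      using len hd s d st by (auto simp: self_avoiding_paths_def dest: in_set_takeD)
    moreover have "map (\<lambda>x. x - w ! m) (drop m w) \<in> ?P n"
    proof -
      have "w ! m \<in> sites" using s len by auto
      then have "set (map (\<lambda>x. x - w ! m) (drop m w)) \<subseteq> sites"
        using s by (auto dest!: in_set_dropD intro: sites_diff)
      moreover have "hd (map (\<lambda>x. x - w ! m) (drop m w)) = 0"
        using len by (simp add: hd_map hd_drop_conv_nth)
      moreover have "distinct (map (\<lambda>x. x - w ! m) (drop m w))"
        using d by (simp add: distinct_map inj_on_def)
      moreover have "l1_norm (map (\<lambda>x. x - w ! m) (drop m w) ! Suc i - map (\<lambda>x. x - w ! m) (drop m w) ! i) = 1"
        if "i < n" for i
        using st[of "m + i"] that len by simp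
      ultimately show ?thesis unfolding self_avoiding_paths_def using len by auto
    qed
    ultimately show "p \<in> ?P m \<times> ?P n" by (simp add: p f_def)
  qed
  ultimately have "card (?P (m + n)) \<le> card (?P m \<times> ?P n)"
    by (intro card_inj_on_le) (auto simp: finite_self_avoiding_paths)
  then show ?thesis by (simp add: card_cartesian_product)
qed

text \<open>Shows that the \<open>lim\<close> in the definition is a genuine limit.\<close>

lemma connective_constant_LIMSEQ:
  "(\<lambda>k. root k (real (card (self_avoiding_paths k :: (real ^ 'd::finite) list set))))
     \<longlonglongrightarrow> connective_constant TYPE('d)"
  unfolding connective_constant_def convergent_LIMSEQ_iff[symmetric]
proof (rule submultiplicative_root_convergent)
  fix m n
  show "1 \<le> real (card (self_avoiding_paths m :: (real ^ 'd) list set))"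
    using card_self_avoiding_paths_ge1[of m, where 'd = 'd] by linarith
  show "real (card (self_avoiding_paths (m + n) :: (real ^ 'd) list set)) \<le>
     real (card (self_avoiding_paths m :: (real ^ 'd) list set)) *
     real (card (self_avoiding_paths n :: (real ^ 'd) list set))"
    using card_self_avoiding_paths_submult[of m n, where 'd = 'd] by (metis of_nat_le_iff of_nat_mult)
qed

lemma connective_constant_nonneg: "0 \<le> connective_constant TYPE('d::finite)"
  by (rule LIMSEQ_le_const[OF connective_constant_LIMSEQ]) (simp add: real_root_ge_zero)

lemma card_self_avoiding_paths_bound:
  assumes "connective_constant TYPE('d::finite) < l"
  obtains K where "0 < K" "\<And>k. real (card (self_avoiding_paths k :: (real ^ 'd) list set)) \<le> K * l ^ k"
  using geometric_bound_of_root_limit[OF _ connective_constant_LIMSEQ assms]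
    connective_constant_nonneg[where 'd = 'd] assms by (metis le_less_trans of_nat_0_le_iff)

text \<open>Outward plus inward steps number \<open>k\<close>, and outward minus inward steps equal
  the final norm.\<close>

lemma card_outward_steps:
  assumes "w \<in> self_avoiding_paths k"
  shows "2 * real (card {i. i < k \<and> l1_norm (w ! i) < l1_norm (w ! Suc i)}) = real k + l1_norm (w ! k)"
proof -
  define Out where "Out n = {i. i < n \<and> l1_norm (w ! i) < l1_norm (w ! Suc i)}" for n
  have fin: "finite (Out n)" for n by (auto simp: Out_def)
  have "n \<le> k \<Longrightarrow> 2 * real (card (Out n)) = real n + l1_norm (w ! n)" for n
  proof (induction n)
    case 0
    then show ?case using self_avoiding_path_nth_0[OF assms] by (simp add: Out_def)
  next
    case (Suc n)
    have adj: "adjacent (w ! n) (w ! Suc n)" using self_avoiding_path_adjacent[OF assms] Suc by simp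
    show ?case
    proof (cases "l1_norm (w ! n) < l1_norm (w ! Suc n)")
      case True
      then have "Out (Suc n) = insert n (Out n)" by (auto simp: Out_def less_Suc_eq)
      then have "card (Out (Suc n)) = Suc (card (Out n))" using fin by (simp add: Out_def)
      then show ?thesis using True adjacent_l1_norm[OF adj] Suc by auto
    next
      case False
      then have "Out (Suc n) = Out n" by (auto simp: Out_def less_Suc_eq)
      then show ?thesis using False adjacent_l1_norm[OF adj] Suc by auto
    qed
  qed
  from this[of k] show ?thesis by (simp add: Out_def)
qed

text \<open>A plaquette determines the pair of sites it separates, and a path with distinct sites
  uses each such pair at most once. Distinctness is what turns independence into a power of
  \<open>p\<close>.\<close>

lemma self_avoiding_path_separator_inj:
  assumes w: "w \<in> self_avoiding_paths k"
  shows "inj_on (\<lambda>i. separator (w ! i) (w ! Suc i)) {i. i < k}"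
proof (rule inj_onI)
  fix i j assume "i \<in> {i. i < k}" "j \<in> {i. i < k}"
    and sep: "separator (w ! i) (w ! Suc i) = separator (w ! j) (w ! Suc j)"
  then have ij: "i < k" "j < k" by simp_all
  have eq: "{w ! i, w ! Suc i} = {w ! j, w ! Suc j}"
    by (rule separator_inj[OF _ _ sep]) (use self_avoiding_path_adjacent[OF w] ij in auto)
  have "distinct w" "length w = k + 1" using w by (auto simp: self_avoiding_paths_def)
  then have "w ! a = w ! b \<longleftrightarrow> a = b" if "a \<le> k" "b \<le> k" for a b
    using that by (simp add: nth_eq_iff_index_eq)
  then show "i = j" using eq ij by (auto simp: doubleton_eq_iff)
qed

section \<open>The cluster of the origin\<close>

definition open_step :: "((real ^ 'd::finite) set \<Rightarrow> bool) \<Rightarrow> real ^ 'd \<Rightarrow> real ^ 'd \<Rightarrow> bool" where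
  "open_step \<omega> x y \<longleftrightarrow> adjacent x y \<and> (l1_norm y < l1_norm x \<or> \<omega> (separator x y))"

definition cluster :: "((real ^ 'd::finite) set \<Rightarrow> bool) \<Rightarrow> (real ^ 'd) set" where
  "cluster \<omega> = {z. (open_step \<omega>)\<^sup>*\<^sup>* 0 z}"

definition open_path :: "((real ^ 'd::finite) set \<Rightarrow> bool) \<Rightarrow> nat \<Rightarrow> (real ^ 'd) list \<Rightarrow> bool" where
  "open_path \<omega> k w \<longleftrightarrow> (\<forall>i<k. open_step \<omega> (w ! i) (w ! Suc i))"

lemma zero_in_cluster: "0 \<in> cluster \<omega>"
  by (simp add: cluster_def)

lemma cluster_step: "x \<in> cluster \<omega> \<Longrightarrow> open_step \<omega> x y \<Longrightarrow> y \<in> cluster \<omega>"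
  by (auto simp: cluster_def intro: rtranclp.rtrancl_into_rtrancl)

lemma cluster_subset_sites: "cluster \<omega> \<subseteq> sites"
proof
  fix z assume "z \<in> cluster \<omega>"
  then have "(open_step \<omega>)\<^sup>*\<^sup>* 0 z" by (simp add: cluster_def)
  then show "z \<in> sites" by induction (auto simp: open_step_def adjacent_def)
qed

lemma inward_closed_cluster: "finite (cluster \<omega>) \<Longrightarrow> inward_closed (cluster \<omega>)"
  by unfold_locales
    (auto simp: zero_in_cluster open_step_def intro: cluster_step cluster_subset_sites[THEN subsetD])

text \<open>An occupied plaquette on the surface would let the cluster step across it, contrary to
  the far site lying outside.\<close>

lemma separating_sphere_surface_cluster:
  assumes "finite (cluster \<omega>)"
  shows "separating_sphere \<omega> (surface (cluster \<omega>))"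
proof -
  interpret inward_closed "cluster \<omega>" by (rule inward_closed_cluster[OF assms])
  have "\<not> \<omega> \<pi>" if "\<pi> \<in> surface (cluster \<omega>)" for \<pi>
    using that cluster_step by (auto simp: surface_def open_step_def)
  then show ?thesis
    unfolding separating_sphere_def
    using finite_surface[OF assms] surface_subset_plaquettes is_sphere_surface zero_inside_surface
    by blast
qed

text \<open>The norm changes by exactly 1 at each step, so no integer level is skipped on the way to
  \<open>z\<close>.\<close>

lemma cluster_level:
  assumes "z \<in> cluster \<omega>" "real n \<le> l1_norm z"
  shows "\<exists>y\<in>cluster \<omega>. l1_norm y = real n"
proof -
  have "(open_step \<omega>)\<^sup>*\<^sup>* 0 z" using assms by (simp add: cluster_def)
  then show ?thesis using assms(2)
  proof induction
    case base
    then show ?case using zero_in_cluster by force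
  next
    case (step y z)
    show ?case
    proof (cases "real n \<le> l1_norm y")
      case False
      have "y \<in> sites" "adjacent y z"
        using step by (auto simp: open_step_def adjacent_def)
      then obtain m where "l1_norm y = real m" "l1_norm z = real m + 1"
        using l1_norm_Nats[of y] adjacent_l1_norm[of y z] False step.prems by force
      moreover from this have "n = m + 1" using False step.prems by linarith
      ultimately have "l1_norm z = real n" by simp
      moreover have "z \<in> cluster \<omega>"
        using step.hyps by (auto simp: cluster_def intro: rtranclp.rtrancl_into_rtrancl)
      ultimately show ?thesis by blast
    qed (use step.IH in blast)
  qed
qed

lemma infinite_cluster_level:
  assumes "infinite (cluster \<omega>)"
  shows "\<exists>y\<in>cluster \<omega>. l1_norm y = real n"
proof -
  have "\<not> cluster \<omega> \<subseteq> {z \<in> sites. l1_norm z \<le> real n}"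
    using assms finite_sites_l1_ball finite_subset by blast
  then obtain z where "z \<in> cluster \<omega>" "real n \<le> l1_norm z"
    using cluster_subset_sites by fastforce
  then show ?thesis by (rule cluster_level)
qed

text \<open>A walk that returns to a visited site is cut back to its first visit there.\<close>

lemma cluster_iff_path:
  "z \<in> cluster \<omega> \<longleftrightarrow> (\<exists>k. \<exists>w\<in>self_avoiding_paths k. w ! k = z \<and> open_path \<omega> k w)"
proof
  assume "z \<in> cluster \<omega>"
  then have "(open_step \<omega>)\<^sup>*\<^sup>* 0 z" by (simp add: cluster_def)
  then show "\<exists>k. \<exists>w\<in>self_avoiding_paths k. w ! k = z \<and> open_path \<omega> k w"
  proof induction
    case base
    have "[0] \<in> self_avoiding_paths 0" by (simp add: self_avoiding_paths_def)
    then show ?case by (force simp: open_path_def)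
  next
    case (step y z)
    then obtain k w where w: "w \<in> self_avoiding_paths k" "w ! k = y" "open_path \<omega> k w" by blast
    have len: "length w = k + 1" and hd: "hd w = 0" and s: "set w \<subseteq> sites" and d: "distinct w"
      and st: "\<And>i. i < k \<Longrightarrow> l1_norm (w ! Suc i - w ! i) = 1"
      using w by (auto simp: self_avoiding_paths_def)
    show ?case
    proof (cases "z \<in> set w")
      case True
      then obtain i where i: "i \<le> k" "w ! i = z" using len by (auto simp: in_set_conv_nth less_Suc_eq_le)
      have "take (i + 1) w \<in> self_avoiding_paths i"
        using len hd s d st i by (auto simp: self_avoiding_paths_def dest: in_set_takeD)
      moreover have "open_path \<omega> i (take (i + 1) w)" using w(3) i by (simp add: open_path_def)
      ultimately show ?thesis using i by (intro exI[of _ i] bexI[of _ "take (i + 1) w"]) auto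
    next
      case False
      have yz: "adjacent y z" using step by (simp add: open_step_def)
      have "w @ [z] \<in> self_avoiding_paths (k + 1)"
        using len hd s d st yz False w(2)
        by (auto simp: self_avoiding_paths_def nth_append adjacent_def hd_append less_Suc_eq)
      moreover have "open_path \<omega> (k + 1) (w @ [z])"
        using w(2,3) step len by (auto simp: open_path_def nth_append less_Suc_eq)
      ultimately show ?thesis
        using len by (intro exI[of _ "k + 1"] bexI[of _ "w @ [z]"]) (auto simp: nth_append)
    qed
  qed
next
  assume "\<exists>k. \<exists>w\<in>self_avoiding_paths k. w ! k = z \<and> open_path \<omega> k w"
  then obtain k w where w: "w \<in> self_avoiding_paths k" "w ! k = z" "open_path \<omega> k w" by blast
  have "i \<le> k \<Longrightarrow> w ! i \<in> cluster \<omega>" for i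
  proof (induction i)
    case 0
    then show ?case using self_avoiding_path_nth_0[OF w(1)] zero_in_cluster by simp
  next
    case (Suc i)
    then show ?case using w(3) by (auto simp: open_path_def intro: cluster_step)
  qed
  then show "z \<in> cluster \<omega>" using w by blast
qed

section \<open>Tail estimates\<close>

locale percolation =
  fixes p :: real and M :: "((real ^ 'd::finite) set \<Rightarrow> bool) measure"
  assumes p: "0 \<le> p" "p \<le> 1"
    and M_def: "M = plaquette_percolation p"
begin

sublocale product_prob_space "\<lambda>_. measure_pmf (bernoulli_pmf p)" "plaquettes :: (real ^ 'd) set set"
  by unfold_locales

lemma M_PiM: "M = PiM plaquettes (\<lambda>_. measure_pmf (bernoulli_pmf p))"
  by (simp add: M_def plaquette_percolation_def)

lemma prob_space_M: "prob_space M"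
  unfolding M_PiM by (rule P.prob_space_axioms)

sublocale M: prob_space M
  by (rule prob_space_M)

section \<open>Measurability of the cluster and its surface\<close>

text \<open>Projections of the product space are measurable at indices in \<open>plaquettes\<close>,
  hence the split on adjacency; otherwise the event is empty.\<close>

lemma measurable_open_step [measurable]: "Measurable.pred M (\<lambda>\<omega>. open_step \<omega> x y)"
proof (cases "adjacent x y")
  case True
  have "(\<lambda>\<omega>. \<omega> (separator x y)) \<in> measurable M (measure_pmf (bernoulli_pmf p))"
    unfolding M_PiM by (rule measurable_component_singleton[OF separator_in_plaquettes[OF True]])
  then have [measurable]: "Measurable.pred M (\<lambda>\<omega>. \<omega> (separator x y))"
    by (simp cong: measurable_cong_sets)
  show ?thesis unfolding open_step_def by measurable
qed (simp add: open_step_def)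

lemma measurable_open_path [measurable]: "Measurable.pred M (\<lambda>\<omega>. open_path \<omega> k w)"
  unfolding open_path_def by measurable

text \<open>Through paths the event becomes a union over countably many lengths and finitely many
  paths of each length.\<close>

lemma measurable_mem_cluster [measurable]: "Measurable.pred M (\<lambda>\<omega>. z \<in> cluster \<omega>)"
  unfolding cluster_iff_path
  by (intro pred_intros_countable pred_intros_finite finite_self_avoiding_paths) measurable

text \<open>The default \<open>{}\<close> for infinite clusters makes the surface a finite set of
  plaquettes for every configuration.\<close>

definition finite_cluster :: "((real ^ 'd) set \<Rightarrow> bool) \<Rightarrow> (real ^ 'd) set" where
  "finite_cluster \<omega> = (if finite (cluster \<omega>) then cluster \<omega> else {})"

text \<open>There are only countably many finite sets of sites, so it suffices to treat the fibres;
  each event \<open>cluster \<omega> = E\<close> is a countable intersection of membership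
  events.\<close>

lemma measurable_finite_cluster:
  "finite_cluster \<in> measurable M (count_space {E. finite E \<and> E \<subseteq> sites})"
proof -
  let ?F = "{E :: (real ^ 'd) set. finite E \<and> E \<subseteq> sites}"
  have count: "countable ?F" by (rule countable_Collect_finite_subset[OF countable_sites])
  have ev: "{\<omega> \<in> space M. cluster \<omega> = E} \<in> sets M" if "E \<in> ?F" for E
  proof -
    have "{\<omega> \<in> space M. cluster \<omega> = E} =
        (\<Inter>z\<in>sites. {\<omega> \<in> space M. z \<in> cluster \<omega> \<longleftrightarrow> z \<in> E})"
      using that cluster_subset_sites zero_in_sites by blast
    also have "\<dots> \<in> sets M"
    proof (intro sets.countable_INT' countable_sites image_subsetI)
      show "sites \<noteq> ({} :: (real ^ 'd) set)" using zero_in_sites by blast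
    qed measurable
    finally show ?thesis .
  qed
  have inf: "{\<omega> \<in> space M. infinite (cluster \<omega>)} \<in> sets M"
  proof -
    have "{\<omega> \<in> space M. infinite (cluster \<omega>)} = space M - (\<Union>E\<in>?F. {\<omega> \<in> space M. cluster \<omega> = E})"
    proof -
      have "infinite (cluster \<omega>) \<longleftrightarrow> (\<forall>E\<in>?F. cluster \<omega> \<noteq> E)" for \<omega> :: "(real ^ 'd) set \<Rightarrow> bool"
        by (metis (mono_tags, lifting) cluster_subset_sites mem_Collect_eq)
      then show ?thesis by simp blast
    qed
    also have "\<dots> \<in> sets M" using ev count by (intro sets.Diff sets.countable_UN') auto
    finally show ?thesis .
  qed
  show ?thesis
    unfolding measurable_count_space_eq_countable[OF count]
  proof (intro conjI ballI)
    show "finite_cluster \<in> space M \<rightarrow> ?F"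
    proof
      show "finite_cluster \<omega> \<in> ?F" for \<omega>
        using cluster_subset_sites[of \<omega>] by (cases "finite (cluster \<omega>)") (simp_all add: finite_cluster_def)
    qed
    fix E assume E: "E \<in> ?F"
    \<comment> \<open>The fibre of \<open>{}\<close> also collects the infinite clusters, for which
      \<open>{}\<close> is the default.\<close>
    have "finite_cluster -` {E} \<inter> space M =
        {\<omega> \<in> space M. cluster \<omega> = E} \<union> (if E = {} then {\<omega> \<in> space M. infinite (cluster \<omega>)} else {})"
      using E by (auto simp: finite_cluster_def split: if_splits)
    then show "finite_cluster -` {E} \<inter> space M \<in> sets M" using ev[OF E] inf by auto
  qed
qed

lemma measurable_surface_finite_cluster:
  "(\<lambda>\<omega>. surface (finite_cluster \<omega>)) \<in> measurable M (count_space {T. finite T \<and> T \<subseteq> plaquettes})"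
  by (rule measurable_compose[OF measurable_finite_cluster])
    (auto simp: finite_surface surface_subset_plaquettes[THEN subsetD])

section \<open>Exponential decay of the cluster\<close>

text \<open>The outward steps of an open path cross \<open>(k + n) / 2\<close> distinct plaquettes,
  which must all be occupied. Using \<open>sqrt p\<close> avoids halving the exponent.\<close>

lemma prob_open_path:
  assumes w: "w \<in> self_avoiding_paths k" and n: "l1_norm (w ! k) = real n"
  shows "measure M {\<omega> \<in> space M. open_path \<omega> k w} \<le> sqrt p ^ (k + n)"
proof -
  define Out where "Out = {i. i < k \<and> l1_norm (w ! i) < l1_norm (w ! Suc i)}"
  define J where "J = (\<lambda>i. separator (w ! i) (w ! Suc i)) ` Out"
  have "finite Out" by (simp add: Out_def)
  then have J: "finite J" "J \<subseteq> plaquettes"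
    using self_avoiding_path_adjacent[OF w] by (auto simp: J_def Out_def separator_in_plaquettes)
  have "card J = card Out"
    unfolding J_def by (rule card_image, rule inj_on_subset[OF self_avoiding_path_separator_inj[OF w]])
      (auto simp: Out_def)
  moreover have "2 * card Out = k + n"
    using card_outward_steps[OF w] n unfolding Out_def by linarith
  ultimately have cJ: "2 * card J = k + n" by simp
  have sub: "{\<omega> \<in> space M. open_path \<omega> k w} \<subseteq> {\<omega> \<in> space M. \<forall>\<pi>\<in>J. \<omega> \<pi> \<in> {True}}"
    by (auto simp: J_def Out_def open_path_def open_step_def)
  have "emeasure M {\<omega> \<in> space M. \<forall>\<pi>\<in>J. \<omega> \<pi> \<in> {True}} = (\<Prod>\<pi>\<in>J. emeasure (bernoulli_pmf p) {True})"
    unfolding M_PiM by (rule emeasure_PiM_Collect[OF J(2,1)]) simp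
  also have "\<dots> = ennreal (p ^ card J)"
    using p by (simp add: emeasure_pmf_single ennreal_power)
  finally have "measure M {\<omega> \<in> space M. \<forall>\<pi>\<in>J. \<omega> \<pi> \<in> {True}} = p ^ card J"
    using p by (simp add: measure_def)
  also have "\<dots> = sqrt p ^ (2 * card J)" using p by (simp add: power_mult)
  also have "\<dots> = sqrt p ^ (k + n)" by (simp only: cJ)
  finally have eq: "measure M {\<omega> \<in> space M. \<forall>\<pi>\<in>J. \<omega> \<pi> \<in> {True}} = sqrt p ^ (k + n)" .
  have "{\<omega> \<in> space M. \<forall>\<pi>\<in>J. \<omega> \<pi> \<in> {True}} \<in> sets M"
    unfolding M_PiM using J by (intro sets.sets_Collect_finite_All sets_Collect_single') auto
  then show ?thesis using M.finite_measure_mono[OF sub] eq by simp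
qed

lemma sets_cluster_level: "{\<omega> \<in> space M. \<exists>z\<in>cluster \<omega>. l1_norm z = real n} \<in> sets M"
proof -
  have "{\<omega> \<in> space M. \<exists>z\<in>cluster \<omega>. l1_norm z = real n} =
      (\<Union>z\<in>{z \<in> sites. l1_norm z = real n}. {\<omega> \<in> space M. z \<in> cluster \<omega>})"
    using cluster_subset_sites by auto
  also have "\<dots> \<in> sets M"
  proof (intro sets.countable_UN' image_subsetI)
    show "countable {z \<in> sites. l1_norm (z :: real ^ 'd) = real n}"
      by (rule countable_subset[OF _ countable_sites]) auto
  qed measurable
  finally show ?thesis .
qed

text \<open>A union bound over open paths ending at level \<open>n\<close>. Length
  \<open>n + j\<close> contributes at most \<open>K * (l * p) ^ n * (l * sqrt p) ^ j\<close>, and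
  the geometric series in \<open>j\<close> converges.\<close>

lemma prob_cluster_level:
  assumes K: "0 < K" "\<And>k. real (card (self_avoiding_paths k :: (real ^ 'd) list set)) \<le> K * l ^ k"
    and l: "0 < l" "l * sqrt p < 1"
  shows "measure M {\<omega> \<in> space M. \<exists>z\<in>cluster \<omega>. l1_norm z = real n} \<le> K / (1 - l * sqrt p) * (l * p) ^ n"
proof -
  \<comment> \<open>A path to level \<open>n\<close> has at least \<open>n\<close> steps;
    \<open>j\<close> is the excess.\<close>
  define P where "P j = {w \<in> self_avoiding_paths (n + j) :: (real ^ 'd) list set. l1_norm (w ! (n + j)) = real n}" for j
  define A where "A j = (\<Union>w\<in>P j. {\<omega> \<in> space M. open_path \<omega> (n + j) w})" for j
  have fin: "finite (P j)" for j
    unfolding P_def using finite_self_avoiding_paths by (rule rev_finite_subset) auto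
  have sets: "A j \<in> sets M" for j
    unfolding A_def by (intro sets.finite_UN fin) measurable
  have sub: "{\<omega> \<in> space M. \<exists>z\<in>cluster \<omega>. l1_norm z = real n} \<subseteq> (\<Union>j. A j)"
  proof safe
    fix \<omega> z assume \<omega>: "\<omega> \<in> space M" "z \<in> cluster \<omega>" "l1_norm z = real n"
    then obtain k w where w: "w \<in> self_avoiding_paths k" "w ! k = z" "open_path \<omega> k w"
      using cluster_iff_path[of z \<omega>] by blast
    then have "n \<le> k" using self_avoiding_path_l1_norm[OF w(1), of k] \<omega>(3) by simp
    then have "\<omega> \<in> A (k - n)" using w \<omega> by (auto simp: A_def P_def)
    then show "\<omega> \<in> (\<Union>j. A j)" by blast
  qed
  have bound: "measure M (A j) \<le> K * (l * p) ^ n * (l * sqrt p) ^ j" for j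
  proof -
    have "measure M (A j) \<le> (\<Sum>w\<in>P j. measure M {\<omega> \<in> space M. open_path \<omega> (n + j) w})"
      unfolding A_def by (rule measure_UNION_le[OF fin]) measurable
    also have "\<dots> \<le> (\<Sum>w\<in>P j. sqrt p ^ (n + j + n))"
      by (intro sum_mono prob_open_path) (auto simp: P_def)
    also have "\<dots> = real (card (P j)) * sqrt p ^ (n + j + n)" by simp
    also have "real (card (P j)) \<le> real (card (self_avoiding_paths (n + j) :: (real ^ 'd) list set))"
      unfolding P_def by (intro of_nat_mono card_mono finite_self_avoiding_paths) auto
    also have "\<dots> \<le> K * l ^ (n + j)" by (rule K)
    also have "K * l ^ (n + j) * sqrt p ^ (n + j + n) = K * (l ^ n * (sqrt p ^ n * sqrt p ^ n)) * (l ^ j * sqrt p ^ j)"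
      by (simp add: power_add)
    also have "sqrt p ^ n * sqrt p ^ n = p ^ n"
      using p by (simp flip: power_mult_distrib)
    finally show ?thesis
      using p by (simp add: power_mult_distrib mult_right_mono)
  qed
  have sp: "0 \<le> l * sqrt p" using l p by simp
  have summ: "summable (\<lambda>j. K * (l * p) ^ n * (l * sqrt p) ^ j)"
    using sp l by (intro summable_mult summable_geometric) simp
  have summA: "summable (\<lambda>j. measure M (A j))"
    by (rule summable_comparison_test[OF _ summ]) (use bound in auto)
  have "measure M {\<omega> \<in> space M. \<exists>z\<in>cluster \<omega>. l1_norm z = real n} \<le> measure M (\<Union>j. A j)"
    using sets by (intro M.finite_measure_mono sub) auto
  also have "\<dots> \<le> (\<Sum>j. measure M (A j))"
    using sets summA by (intro M.finite_measure_subadditive_countably) auto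
  also have "\<dots> \<le> (\<Sum>j. K * (l * p) ^ n * (l * sqrt p) ^ j)"
    by (rule suminf_le[OF bound summA summ])
  also have "\<dots> = K * (l * p) ^ n * (1 / (1 - l * sqrt p))"
    using sp l by (subst suminf_mult) (auto simp: suminf_geometric summable_geometric)
  finally show ?thesis by simp
qed

lemma connective_constant_sqrt_less_1:
  assumes "p < 1 / (connective_constant TYPE('d))\<^sup>2"
  shows "connective_constant TYPE('d) * sqrt p < 1"
\<comment> \<open>The value 0 is treated apart because division by 0 yields 0; there the product is
  0.\<close>
proof (cases "connective_constant TYPE('d) = 0")
  case False
  then have "(connective_constant TYPE('d) * sqrt p)\<^sup>2 < 1"
    using assms p by (simp add: power_mult_distrib field_simps)
  then show ?thesis
    using connective_constant_nonneg[where 'd = 'd] p by (simp add: power_less_one_iff)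
qed simp

text \<open>Both hypotheses are strict, so \<open>l\<close> can be chosen above the connective
  constant with \<open>l * sqrt p < 1\<close> and \<open>l * p \<le> \<alpha>\<close> still
  valid.\<close>

lemma cluster_tail:
  assumes "p < 1 / (connective_constant TYPE('d))\<^sup>2" "connective_constant TYPE('d) * p < \<alpha>"
  shows "\<exists>C>0. \<forall>n. measure M {\<omega> \<in> space M. \<exists>z\<in>cluster \<omega>. l1_norm z = real n} \<le> C * \<alpha> ^ n"
proof -
  define \<mu> where "\<mu> = connective_constant TYPE('d)"
  have \<mu>: "0 \<le> \<mu>" unfolding \<mu>_def by (rule connective_constant_nonneg)
  obtain l where l: "\<mu> < l" "l * sqrt p < 1" "l * p \<le> \<alpha>"
  proof (cases "p = 0")
    \<comment> \<open>For \<open>p = 0\<close> both products vanish, and the second assumption gives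
      \<open>0 < \<alpha>\<close>.\<close>
    case True
    with that[of "\<mu> + 1"] assms(2) show ?thesis by simp
  next
    case False
    then have "0 < p" using p by simp
    then have "\<mu> < min (1 / sqrt p) (\<alpha> / p)"
      using connective_constant_sqrt_less_1[OF assms(1)] assms(2) by (simp add: field_simps \<mu>_def)
    then obtain l where "\<mu> < l" "l < 1 / sqrt p" "l < \<alpha> / p"
      using dense by (metis min_less_iff_conj)
    with that[of l] \<open>0 < p\<close> show ?thesis by (simp add: field_simps)
  qed
  obtain K where K: "0 < K" "\<And>k. real (card (self_avoiding_paths k :: (real ^ 'd) list set)) \<le> K * l ^ k"
    using card_self_avoiding_paths_bound l(1) unfolding \<mu>_def by blast
  have "0 < l" using l \<mu> by simp
  define C where "C = K / (1 - l * sqrt p)"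
  have C: "0 < C" using K l by (simp add: C_def)
  have "measure M {\<omega> \<in> space M. \<exists>z\<in>cluster \<omega>. l1_norm z = real n} \<le> C * \<alpha> ^ n" for n
  proof -
    have "C * (l * p) ^ n \<le> C * \<alpha> ^ n"
      using C l(3) \<open>0 < l\<close> p by (intro mult_left_mono power_mono) auto
    then show ?thesis
      using prob_cluster_level[OF K \<open>0 < l\<close> l(2), of n] by (simp add: C_def)
  qed
  with C show ?thesis by blast
qed

text \<open>An infinite cluster meets every level, while the probability of meeting level
  \<open>n\<close> tends to 0.\<close>

lemma AE_finite_cluster:
  assumes "p < 1 / (connective_constant TYPE('d))\<^sup>2"
  shows "AE \<omega> in M. finite (cluster \<omega>)"
proof -
  define \<mu> where "\<mu> = connective_constant TYPE('d)"
  have \<mu>: "0 \<le> \<mu>" unfolding \<mu>_def by (rule connective_constant_nonneg)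
  \<comment> \<open>This makes room for a decay rate strictly below 1.\<close>
  have "\<mu> * p = (\<mu> * sqrt p) * sqrt p" using p by simp
  also have "\<dots> \<le> \<mu> * sqrt p" using p \<mu> by (intro mult_right_le_one_le) auto
  also have "\<dots> < 1" unfolding \<mu>_def by (rule connective_constant_sqrt_less_1[OF assms])
  finally obtain \<beta> where "\<mu> * p < \<beta>" "\<beta> < 1" using dense by blast
  then have \<beta>: "0 \<le> \<beta>" "\<beta> < 1" using \<mu> p mult_nonneg_nonneg[of \<mu> p] by linarith+
  obtain C where b: "\<And>n. measure M {\<omega> \<in> space M. \<exists>z\<in>cluster \<omega>. l1_norm z = real n} \<le> C * \<beta> ^ n"
    using cluster_tail[OF assms] \<open>\<mu> * p < \<beta>\<close> unfolding \<mu>_def by blast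
  define N where "N = (\<Inter>n. {\<omega> \<in> space M. \<exists>z\<in>cluster \<omega>. l1_norm z = real n})"
  have N: "N \<in> sets M" unfolding N_def using sets_cluster_level by (intro sets.countable_INT) auto
  have le: "measure M N \<le> C * \<beta> ^ n" for n
    using M.finite_measure_mono[OF _ sets_cluster_level, of N n] b[of n] by (force simp: N_def)
  have "(\<lambda>n. C * \<beta> ^ n) \<longlonglongrightarrow> C * 0"
    using \<beta> by (intro tendsto_mult tendsto_const LIMSEQ_power_zero) simp
  then have "measure M N \<le> 0" using LIMSEQ_le_const le by fastforce
  then have "emeasure M N = 0" using M.emeasure_eq_measure measure_nonneg[of M N] by simp
  then have "N \<in> null_sets M" using N by auto
  then show ?thesis
    by (rule AE_I') (auto simp: N_def intro: infinite_cluster_level)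
qed

section \<open>From the cluster to the radius of its surface\<close>

text \<open>Each surface point lies in a cube of the cluster, hence within
  \<open>CARD('d) / 2\<close> in norm of its centre, so a large radius forces a distant
  site.\<close>

lemma large_radius_imp_level:
  assumes "rad (\<Union>(surface (finite_cluster \<omega>))) \<ge> ereal r"
  shows "\<exists>z\<in>cluster \<omega>. l1_norm z = real (nat \<lceil>r - CARD('d) / 2\<rceil>)"
proof (rule ccontr)
  let ?n = "nat \<lceil>r - CARD('d) / 2\<rceil>"
  assume no: "\<not> ?thesis"
  then have lt: "l1_norm z < real ?n" if "z \<in> cluster \<omega>" for z
    using cluster_level that by (meson not_le)
  \<comment> \<open>Level 0 is always attained, by the origin; this also covers negative arguments,
    which \<open>nat\<close> sends to 0.\<close>
  have "?n \<noteq> 0" using no zero_in_cluster by force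
  \<comment> \<open>Integrality gains a full unit, which outweighs the rounding up in
    \<open>?n\<close>.\<close>
  have "l1_norm z \<le> real ?n - 1" if z: "z \<in> cluster \<omega>" for z
  proof -
    obtain m where "l1_norm z = real m" using l1_norm_Nats z cluster_subset_sites by blast
    moreover from this have "m + 1 \<le> ?n" using lt[OF z] by linarith
    ultimately show ?thesis by linarith
  qed
  then have "l1_norm v \<le> real ?n - 1 + CARD('d) / 2" if "v \<in> unit_cube z" "z \<in> cluster \<omega>" for v z
    using l1_norm_bound_unit_cube[OF that(1)] that(2) by (smt (verit))
  then have "rad (\<Union>(surface (finite_cluster \<omega>))) \<le> ereal (real ?n - 1 + CARD('d) / 2)"
    unfolding rad_def
    by (intro SUP_least) (auto simp: surface_def separator_def finite_cluster_def split: if_splits)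
  moreover have "real ?n - 1 + CARD('d) / 2 < r" using \<open>?n \<noteq> 0\<close> by linarith
  ultimately show False using assms by (meson ereal_less_eq(3) not_le order_trans)
qed

text \<open>The shift by \<open>CARD('d) / 2\<close> costs the constant factor
  \<open>\<alpha> powr (- (CARD('d) / 2))\<close>, which does not depend on
  \<open>r\<close>.\<close>

lemma radius_tail:
  assumes "p < 1 / (connective_constant TYPE('d))\<^sup>2"
    and \<alpha>: "connective_constant TYPE('d) * p < \<alpha>" "\<alpha> < 1"
  shows "\<exists>C. \<forall>r>0. measure M {\<omega> \<in> space M. rad (\<Union>(surface (finite_cluster \<omega>))) \<ge> ereal r} \<le> C * \<alpha> powr r"
proof -
  obtain C where C: "0 < C"
    "\<And>n. measure M {\<omega> \<in> space M. \<exists>z\<in>cluster \<omega>. l1_norm z = real n} \<le> C * \<alpha> ^ n"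
    using cluster_tail[OF assms(1) \<alpha>(1)] by blast
  have "0 < \<alpha>"
    using \<alpha>(1) p connective_constant_nonneg[where 'd = 'd] by (smt (verit) mult_nonneg_nonneg)
  have "measure M {\<omega> \<in> space M. rad (\<Union>(surface (finite_cluster \<omega>))) \<ge> ereal r}
      \<le> C * \<alpha> powr (- (CARD('d) / 2)) * \<alpha> powr r" for r
  proof -
    let ?n = "nat \<lceil>r - CARD('d) / 2\<rceil>"
    have "measure M {\<omega> \<in> space M. rad (\<Union>(surface (finite_cluster \<omega>))) \<ge> ereal r}
        \<le> measure M {\<omega> \<in> space M. \<exists>z\<in>cluster \<omega>. l1_norm z = real ?n}"
      by (intro M.finite_measure_mono sets_cluster_level) (use large_radius_imp_level in blast)
    also have "\<dots> \<le> C * \<alpha> powr real ?n" using C(2)[of ?n] \<open>0 < \<alpha>\<close> by (simp add: powr_realpow)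
    also have "\<dots> \<le> C * \<alpha> powr (r - CARD('d) / 2)"
      using C(1) \<open>0 < \<alpha>\<close> \<alpha>(2) by (intro mult_left_mono powr_mono') linarith+
    also have "\<dots> = C * \<alpha> powr (- (CARD('d) / 2)) * \<alpha> powr r"
      by (simp flip: powr_add)
    finally show ?thesis .
  qed
  then show ?thesis by blast
qed

end

theorem theorem1:
  fixes p :: real
  defines "\<mu> \<equiv> connective_constant TYPE('d::finite)"
    and "M \<equiv> (plaquette_percolation p :: ((real ^ 'd) set \<Rightarrow> bool) measure)"
  assumes "CARD('d) \<ge> 2"
    and "0 \<le> p" "p \<le> 1"
    and "p < 1 / \<mu>\<^sup>2"
  shows "(AE \<omega> in M. \<exists>S. separating_sphere \<omega> S) \<and>
    (\<exists>S \<in> measurable M (count_space {T. finite T \<and> T \<subseteq> plaquettes}).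
       (AE \<omega> in M. separating_sphere \<omega> (S \<omega>)) \<and>
       (\<forall>\<alpha>. \<mu> * p < \<alpha> \<and> \<alpha> < 1 \<longrightarrow>
          (\<exists>C. \<forall>r>0. measure M {\<omega> \<in> space M. rad (\<Union>(S \<omega>)) \<ge> ereal r} \<le> C * \<alpha> powr r)))"
proof -
  interpret percolation p M
    by unfold_locales (use assms(4,5) in \<open>simp_all add: M_def\<close>)
  have AE: "AE \<omega> in M. separating_sphere \<omega> (surface (finite_cluster \<omega>))"
    using AE_finite_cluster[OF assms(6)[unfolded \<mu>_def]]
    by eventually_elim (simp add: finite_cluster_def separating_sphere_surface_cluster)
  then have "AE \<omega> in M. \<exists>S. separating_sphere \<omega> S" by eventually_elim blast
  moreover have "\<forall>\<alpha>. \<mu> * p < \<alpha> \<and> \<alpha> < 1 \<longrightarrow>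
      (\<exists>C. \<forall>r>0. measure M {\<omega> \<in> space M. rad (\<Union>(surface (finite_cluster \<omega>))) \<ge> ereal r} \<le> C * \<alpha> powr r)"
    using radius_tail assms(6) unfolding \<mu>_def by blast
  \<comment> \<open>One random set serves all \<open>\<alpha>\<close> at once, since it is defined
    without reference to the rate.\<close>
  ultimately show ?thesis
    using AE measurable_surface_finite_cluster
    by (intro conjI bexI[of _ "\<lambda>\<omega>. surface (finite_cluster \<omega>)"])
qed

end
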